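(* There exist two positive constants $C_5$ and $C_6$ such that: (1) for every sufficiently large integer $n$, $$\log K(n)\le \rho\log n-C_5\,\frac{(\log n)^{1/\rho}}{\log\log n};$$ (2) for every sufficiently large integer $n$ there exists a positive integer $m\le n$ such that $$\log K(m)\ge \rho\log n-C_6\,\frac{(\log n)^{1/\rho}}{\log\log n}\ge \rho\log m-C_6\,\frac{(\log m)^{1/\rho}}{\log\log m}.$$
   Context: $K$ is the Kalmár function: $K(1)=1$ and, for $n\ge 2$, $K(n)$ is the number of ordered factorizations $n=x_1x_2\cdots x_r$ ($r\ge1$ arbitrary) into integers $x_i\ge 2$ (the order of the factors counts). Let $\zeta$ be the Riemann zeta function; $\rho=1.7286\ldots$ is the unique real number $>1$ with $\zeta(\rho)=2$. *)

theory Defs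
  imports "HOL-Analysis.Analysis"
begin

definition ordered_factorizations :: "nat \<Rightarrow> nat list set" where
  "ordered_factorizations n = {xs. xs \<noteq> [] \<and> (\<forall>x\<in>set xs. x \<ge> 2) \<and> prod_list xs = n}"

text \<open>The Kalmar function is of interest only for positive arguments;
  the definition gives the value 0 at 0.\<close>

definition kalmar :: "nat \<Rightarrow> nat" where
  "kalmar n = (if n = 1 then 1 else card (ordered_factorizations n))"

text \<open>The Riemann zeta function on the real half-line \<open>s > 1\<close>, given by its Dirichlet series.
  For \<open>s \<le> 1\<close> the series diverges and the value has no meaning.\<close>

definition zeta :: "real \<Rightarrow> real" where
  "zeta s = (\<Sum>n. 1 / real (Suc n) powr s)"

definition kalmar_rho :: real where
  "kalmar_rho = (THE s. s > 1 \<and> zeta s = 2)"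

end

theory Submission
  imports Defs "HOL-Computational_Algebra.Primes"
begin

text \<open>
Write \<open>\<rho>\<close> for \<open>kalmar_rho\<close>, \<open>L = ln n\<close> and \<open>y = L\<^bsup>1/\<rho>\<^esup>\<close>, so that the error term
\<open>L\<^bsup>1/\<rho>\<^esup> / ln L\<close> is, up to the factor \<open>\<rho>\<close>, \<open>y / ln y\<close>: the order of the number of primes up to \<open>y\<close>.
Since \<open>\<zeta>(\<rho>) = 2\<close>, the numbers \<open>x\<^bsup>-\<rho>\<^esup>\<close> with \<open>x \<ge> 2\<close> form a probability distribution, and
\<open>K(n) / n\<^bsup>\<rho>\<^esup>\<close> is the probability that the partial products of independent factors drawn from it
ever equal \<open>n\<close>. About \<open>L\<close> factors are drawn, so a prime \<open>p\<close> near \<open>y\<close> is expected to divide the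
product a bounded number of times. Prescribing the exponent of each such prime costs a constant
factor per prime, hence \<open>exp (- c y / ln y)\<close> altogether. Conversely, avoiding all primes above
\<open>y\<close> costs no more than \<open>exp (- C y / ln y)\<close>, and the typical products that avoid them take only
\<open>exp (O(y / ln y))\<close> values. The proof makes both halves
precise with \<open>K(n) = \<Sum>K(n/d)\<close>, the sum over the divisors \<open>d \<ge> 2\<close> (\<open>kalmar_rec\<close>), and test
functions.

Upper bound (\<open>kalmar_upper\<close>). If \<open>G(1) \<ge> 1\<close> and \<open>\<Sum>G(m/d) \<le> G(m)\<close> over the divisors \<open>d \<ge> 2\<close>
of each \<open>m \<ge> 2\<close>, then \<open>K \<le> G\<close>. The interval \<open>(a y, B a y]\<close> contains at least a constant times \<open>y / ln y\<close> primes
(\<open>many_primes_in_interval\<close>), and \<open>a\<close> is chosen large enough for the expected exponent of each of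
them in a typical product to be well below \<open>1\<close>. At least half of these primes do not divide \<open>n\<close>,
or at least half of them do. In the first case those primes that do not divide \<open>n\<close>
are excluded as factors, so that an exponent \<open>s\<close> slightly below \<open>\<rho>\<close> is admissible in \<open>G(m) = m\<^bsup>s\<^esup>\<close>
(\<open>kalmar_le_of_coprime_primes\<close>). In the second case, \<open>G(m) = m\<^bsup>s\<^esup> / 2\<^bsup>w(m)\<^esup>\<close>, where \<open>w(m)\<close> counts
those primes of the interval that divide both \<open>n\<close> and \<open>m\<close>, is admissible for an \<open>s\<close> slightly above \<open>\<rho>\<close>; the gain
\<open>2\<^bsup>-w(n)\<^esup>\<close> outweighs the increase of the exponent, precisely because those primes are expected to
occur too rarely (\<open>kalmar_le_of_prime_divisors\<close>).

Lower bound (\<open>kalmar_lower\<close>). Let \<open>u\<close> be completely multiplicative with \<open>0 \<le> u \<le> 1\<close>, suppose that all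
partial sums of \<open>u\<close> are at most \<open>N\<close>, and let \<open>s\<close> be such that \<open>\<Sum>u(x) x\<^bsup>-s\<^esup> \<ge> 1\<close> over \<open>x \<ge> 2\<close>.
The recursion gives \<open>\<Sum>u(m) K(m) \<ge> n\<^bsup>s\<^esup> / N\<close> over \<open>m \<le> n\<close> by induction, so some \<open>m \<le> n\<close> has
\<open>K(m) \<ge> n\<^bsup>s\<^esup> / N\<^sup>2\<close> (\<open>kalmar_large_value\<close>). The choice \<open>u(p) = 1 - (p/y)\<^bsup>s\<^esup>\<close> for primes \<open>p \<le> y\<close>
and \<open>u(p) = 0\<close> for larger \<open>p\<close> balances the two costs: Chebyshev's bound
\<open>\<Sum>ln p \<le> n ln 4\<close> over the primes up to \<open>n\<close> yields \<open>ln N = O(y / ln y)\<close> and shows that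
\<open>s = \<rho> - O(y\<^bsup>1-\<rho>\<^esup> / ln y)\<close> is admissible, so that also \<open>(\<rho> - s) L = O(y / ln y)\<close>.

The second inequality in part (2) holds because \<open>\<rho> x - C x\<^bsup>1/\<rho>\<^esup> / ln x\<close> increases for large \<open>x\<close>,
while \<open>K(m) \<le> m\<^bsup>\<rho>\<^esup>\<close> forces the \<open>m\<close> just found to be large.
\<close>

section \<open>Sums over multiples and over primes\<close>

lemma sum_multiples:
  fixes F :: "nat \<Rightarrow> real"
  assumes "p > 0"
  shows "(\<Sum>x\<in>{x\<in>{1..X}. p dvd x}. F x) = (\<Sum>x=1..X div p. F (p * x))"
proof -
  have "{x\<in>{1..X}. p dvd x} = (\<lambda>x. p * x) ` {1..X div p}"
  proof (intro equalityI subsetI)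
    fix x assume "x \<in> {x\<in>{1..X}. p dvd x}"
    then obtain k where "x = p * k" "1 \<le> x" "x \<le> X" by auto
    then show "x \<in> (\<lambda>x. p * x) ` {1..X div p}"
      using assms by (auto simp: less_eq_div_iff_mult_less_eq mult.commute intro!: imageI)
  next
    fix x assume "x \<in> (\<lambda>x. p * x) ` {1..X div p}"
    then show "x \<in> {x\<in>{1..X}. p dvd x}"
      using assms by (auto simp: less_eq_div_iff_mult_less_eq mult.commute)
  qed
  moreover have "inj_on (\<lambda>x. p * x) {1..X div p}"
    using assms by (auto simp: inj_on_def)
  ultimately show ?thesis by (simp add: sum.reindex)
qed

text \<open>Each multiple \<open>p x\<close> has multiplicity one more than \<open>x\<close>. The resulting self-reference of sums of
multiplicities replaces the usual sums over all prime powers.\<close>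

lemma sum_multiplicity:
  fixes g :: "nat \<Rightarrow> real"
  assumes "prime p"
  shows "(\<Sum>x=1..X. g x * real (multiplicity p x))
    = (\<Sum>x=1..X div p. g (p * x) * (1 + real (multiplicity p x)))"
proof -
  have "(\<Sum>x=1..X. g x * real (multiplicity p x))
      = (\<Sum>x\<in>{x\<in>{1..X}. p dvd x}. g x * real (multiplicity p x))"
    by (intro sum.mono_neutral_right) (auto simp: not_dvd_imp_multiplicity_0)
  also have "\<dots> = (\<Sum>x=1..X div p. g (p * x) * real (multiplicity p (p * x)))"
    using assms by (intro sum_multiples) (auto simp: prime_gt_0_nat)
  also have "\<dots> = (\<Sum>x=1..X div p. g (p * x) * (1 + real (multiplicity p x)))"
  proof (intro sum.cong refl)
    fix x assume "x \<in> {1..X div p}"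
    then have "multiplicity p (p * x) = Suc (multiplicity p x)"
      using assms by (intro multiplicity_times_same) (auto simp: prime_gt_0_nat)
    then show "g (p * x) * real (multiplicity p (p * x)) = g (p * x) * (1 + real (multiplicity p x))"
      by simp
  qed
  finally show ?thesis .
qed

lemma prod_primes_dvd:
  fixes S :: "nat set"
  assumes "finite S" "\<And>p. p \<in> S \<Longrightarrow> prime p" "\<And>p. p \<in> S \<Longrightarrow> p dvd m"
  shows "\<Prod>S dvd m"
  using assms
proof (induction S rule: finite_induct)
  case (insert q S)
  have "coprime q (\<Prod>S)"
    using insert by (intro prod_coprime_right) (auto intro!: primes_coprime)
  then show ?case using insert by (auto intro!: divides_mult)
qed auto

text \<open>Chebyshev's bound, by induction from \<open>m + 1\<close> to \<open>2 m + 1\<close>: the primes between them divide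
the binomial coefficient \<open>2 m + 1\<close> over \<open>m\<close>, which is at most \<open>4\<^sup>m\<close>.\<close>

lemma sum_ln_primes_le: "(\<Sum>p | prime p \<and> p \<le> n. ln (real p)) \<le> ln 4 * real n"
proof (induction n rule: less_induct)
  case (less n)
  consider "n \<le> 1" | "n = 2" | "n > 2" "even n" | "n > 2" "odd n" by linarith
  then show ?case
  proof cases
    case 1
    then have "{p. prime p \<and> p \<le> n} = {}" by (auto dest: prime_gt_1_nat)
    then show ?thesis by (metis ln_ge_zero mult_nonneg_nonneg of_nat_0_le_iff one_le_numeral sum.empty)
  next
    case 2
    then have "{p. prime p \<and> p \<le> n} = {2::nat}"
      by (auto dest: prime_gt_1_nat intro: antisym)
    moreover have "ln (2::real) \<le> ln 4 * 2"
      using ln_le_cancel_iff[of 2 "4::real"] ln_ge_zero[of 4] by linarith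
    ultimately show ?thesis using 2 by simp
  next
    case 3
    then have "\<not> prime n" by (metis nat_neq_iff prime_nat_iff' primes_dvd_imp_eq two_is_prime_nat)
    then have "{p. prime p \<and> p \<le> n} = {p. prime p \<and> p \<le> n - 1}"
      by (auto simp: le_less)
    moreover have "ln 4 * real (n - 1) \<le> ln (4::real) * real n" by (intro mult_left_mono) auto
    moreover have "(\<Sum>p | prime p \<and> p \<le> n - 1. ln (real p)) \<le> ln 4 * real (n - 1)"
      using 3 by (intro less) auto
    ultimately show ?thesis by (metis order_trans)
  next
    case 4
    then obtain m where m: "n = 2 * m + 1" "m \<ge> 1" by (auto elim!: oddE)
    define S where "S = {p. prime p \<and> m + 1 < p \<and> p \<le> n}"
    have fin: "finite S" unfolding S_def by (rule finite_subset[of _ "{..n}"]) auto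
    have "\<Prod>S dvd n choose m"
    proof (rule prod_primes_dvd[OF fin])
      fix p assume p: "p \<in> S"
      then show "prime p" by (simp add: S_def)
      have "p dvd fact n" using p prime_dvd_fact_iff by (auto simp: S_def)
      also have "fact n = fact m * fact (n - m) * (n choose m)"
        using binomial_fact_lemma[of m n] m by simp
      finally have "p dvd fact m \<or> p dvd fact (n - m) \<or> p dvd n choose m"
        using \<open>prime p\<close> by (simp add: prime_dvd_mult_iff)
      moreover have "\<not> p dvd fact m" "\<not> p dvd fact (n - m)"
        using p m unfolding prime_dvd_fact_iff[OF \<open>prime p\<close>] by (auto simp: S_def)
      ultimately show "p dvd n choose m" by blast
    qed
    then have le1: "\<Prod>S \<le> n choose m" using m by (intro dvd_imp_le) auto
    have "(n choose m) + (n choose (Suc m)) = (\<Sum>k\<in>{m, Suc m}. n choose k)" by simp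
    also have "\<dots> \<le> (\<Sum>k\<le>n. n choose k)" using m by (intro sum_mono2) auto
    also have "\<dots> = 2 ^ n" by (rule choose_row_sum)
    also have "n choose (Suc m) = n choose m"
      using m binomial_symmetric[of m n] by simp
    finally have "n choose m \<le> 4 ^ m" using m by (simp add: power_mult)
    with le1 have "real (\<Prod>S) \<le> 4 ^ m"
      by (metis le_trans of_nat_le_iff of_nat_numeral of_nat_power)
    moreover have "real (\<Prod>S) = (\<Prod>p\<in>S. real p)" by simp
    moreover have pos: "\<And>p. p \<in> S \<Longrightarrow> real p > 0" by (auto simp: S_def)
    ultimately have "ln (\<Prod>p\<in>S. real p) \<le> ln (4 ^ m)"
      using fin by (subst ln_le_cancel_iff) (auto intro!: prod_pos)
    then have "(\<Sum>p\<in>S. ln (real p)) \<le> real m * ln 4"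
      using fin pos by (subst (asm) ln_prod) (auto simp: ln_realpow)
    moreover have "{p. prime p \<and> p \<le> n} = {p. prime p \<and> p \<le> m + 1} \<union> S"
      using m by (auto simp: S_def)
    then have "(\<Sum>p | prime p \<and> p \<le> n. ln (real p))
        = (\<Sum>p | prime p \<and> p \<le> m + 1. ln (real p)) + (\<Sum>p\<in>S. ln (real p))"
      using fin by (auto simp: S_def intro!: sum.union_disjoint)
    moreover have "(\<Sum>p | prime p \<and> p \<le> m + 1. ln (real p)) \<le> ln 4 * real (m + 1)"
      using m by (intro less) auto
    ultimately have "(\<Sum>p | prime p \<and> p \<le> n. ln (real p)) \<le> ln 4 * real (m + 1) + real m * ln 4"
      by linarith
    then show ?thesis using m by (simp add: algebra_simps)
  qed
qed

text \<open>Abel summation.\<close>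

lemma sum_mult_antitone_nonneg:
  fixes b h :: "nat \<Rightarrow> real"
  assumes "\<And>k. (\<Sum>m=1..k. b m) \<ge> 0"
    and "\<And>m. h m \<ge> 0" and "\<And>m. m \<ge> 1 \<Longrightarrow> h (Suc m) \<le> h m"
  shows "(\<Sum>m=1..n. b m * h m) \<ge> 0"
proof -
  have "(\<Sum>m=1..n. b m * h m) \<ge> h n * (\<Sum>m=1..n. b m)"
  proof (induction n)
    case (Suc n)
    have "h (Suc n) * (\<Sum>m=1..n. b m) \<le> h n * (\<Sum>m=1..n. b m)"
    proof (cases "n = 0")
      case False
      then show ?thesis using assms by (intro mult_right_mono) auto
    qed auto
    with Suc show ?case by (simp add: algebra_simps)
  qed auto
  then show ?thesis
    using assms(1)[of n] assms(2)[of n] by (meson mult_nonneg_nonneg order_trans)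
qed

text \<open>As far as decreasing functions are concerned, Chebyshev's bound lets the weights \<open>ln p\<close> on the
primes be replaced by the constant weight \<open>ln 4\<close> on all integers.\<close>

lemma sum_ln_primes_antitone_le:
  fixes h :: "nat \<Rightarrow> real"
  assumes "\<And>m. h m \<ge> 0" and "\<And>m. m \<ge> 1 \<Longrightarrow> h (Suc m) \<le> h m"
  shows "(\<Sum>p | prime p \<and> p \<le> n. ln (real p) * h p) \<le> ln 4 * (\<Sum>m=1..n. h m)"
proof -
  define a where "a m = (if prime m then ln (real m) else 0)" for m :: nat
  have conv: "(\<Sum>p | prime p \<and> p \<le> k. ln (real p) * g p) = (\<Sum>m=1..k. a m * g m)"
    for k and g :: "nat \<Rightarrow> real"
  proof -
    have "(\<Sum>m=1..k. a m * g m) = (\<Sum>p | prime p \<and> p \<le> k. a p * g p)"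
      by (intro sum.mono_neutral_right)
        (auto simp: a_def dest: prime_ge_1_nat)
    then show ?thesis by (simp add: a_def)
  qed
  have "(\<Sum>m=1..n. (ln 4 - a m) * h m) \<ge> 0"
  proof (rule sum_mult_antitone_nonneg)
    fix k
    show "(\<Sum>m=1..k. ln 4 - a m) \<ge> 0"
      using sum_ln_primes_le[of k] conv[where k = k and g = "\<lambda>_. 1"] by (simp add: sum_subtractf mult.commute)
  qed (use assms in auto)
  then show ?thesis
    unfolding conv by (simp add: algebra_simps sum_subtractf sum_distrib_left)
qed

text \<open>Saves a factor \<open>ln y\<close> over the sum over all integers: the primes below \<open>\<surd>y\<close> are estimated
trivially, and for the others \<open>ln p \<ge> ln y / 2\<close>.\<close>

lemma sum_primes_antitone_le:
  fixes h :: "nat \<Rightarrow> real"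
  assumes "\<And>m. h m \<ge> 0" and "\<And>m. m \<ge> 1 \<Longrightarrow> h (Suc m) \<le> h m" and "y > 1"
  shows "(\<Sum>p | prime p \<and> p \<le> n. h p) \<le> sqrt y * h 1 + 2 * ln 4 / ln y * (\<Sum>m=1..n. h m)"
proof -
  have mono: "h m \<le> h 1" if "m \<ge> 1" for m
    using that
  proof (induction m rule: dec_induct)
    case (step m)
    then show ?case using assms(2)[of m] by linarith
  qed auto
  have "(\<Sum>p | prime p \<and> p \<le> n. h p) = (\<Sum>p | prime p \<and> p \<le> n \<and> real p < sqrt y. h p)
      + (\<Sum>p | prime p \<and> p \<le> n \<and> real p \<ge> sqrt y. h p)"
    by (subst sum.union_disjoint[symmetric]) (auto intro!: sum.cong)
  moreover have "(\<Sum>p | prime p \<and> p \<le> n \<and> real p < sqrt y. h p) \<le> sqrt y * h 1"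
  proof -
    let ?S = "{p. prime p \<and> p \<le> n \<and> real p < sqrt y}"
    have sub: "?S \<subseteq> {1..nat \<lfloor>sqrt y\<rfloor>}"
      by (auto dest: prime_ge_1_nat simp: le_nat_floor)
    have "(\<Sum>p\<in>?S. h p) \<le> (\<Sum>p\<in>?S. h 1)" by (intro sum_mono mono) (auto dest: prime_ge_1_nat)
    also have "\<dots> = real (card ?S) * h 1" by simp
    also have "real (card ?S) \<le> real (nat \<lfloor>sqrt y\<rfloor>)"
      using card_mono[OF _ sub] by simp
    also have "\<dots> \<le> sqrt y" using assms(3) by (simp add: of_nat_floor)
    finally show ?thesis using assms(1) by (simp add: mult_right_mono)
  qed
  moreover have "(\<Sum>p | prime p \<and> p \<le> n \<and> real p \<ge> sqrt y. h p)
      \<le> 2 / ln y * (\<Sum>p | prime p \<and> p \<le> n. ln (real p) * h p)"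
  proof -
    have "(\<Sum>p | prime p \<and> p \<le> n \<and> real p \<ge> sqrt y. h p)
       \<le> (\<Sum>p | prime p \<and> p \<le> n \<and> real p \<ge> sqrt y. 2 / ln y * (ln (real p) * h p))"
    proof (intro sum_mono)
      fix p assume p: "p \<in> {p. prime p \<and> p \<le> n \<and> real p \<ge> sqrt y}"
      have "ln (sqrt y) \<le> ln (real p)" using p assms(3) by (subst ln_le_cancel_iff) (auto simp: prime_gt_0_nat)
      then have "1 \<le> 2 / ln y * ln (real p)" using assms(3) by (simp add: ln_sqrt field_simps)
      then show "h p \<le> 2 / ln y * (ln (real p) * h p)"
        using mult_right_mono[OF _ assms(1)[of p]] by (metis mult.assoc mult_1)
    qed
    also have "\<dots> \<le> (\<Sum>p | prime p \<and> p \<le> n. 2 / ln y * (ln (real p) * h p))"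
      using assms by (intro sum_mono2)
        (auto intro!: mult_nonneg_nonneg divide_nonneg_nonneg simp: prime_gt_0_nat Suc_leI)
    finally show ?thesis by (simp add: sum_distrib_left)
  qed
  moreover have "2 / ln y * (\<Sum>p | prime p \<and> p \<le> n. ln (real p) * h p)
      \<le> 2 / ln y * (ln 4 * (\<Sum>m=1..n. h m))"
    using assms by (intro mult_left_mono sum_ln_primes_antitone_le) auto
  ultimately show ?thesis by simp
qed

section \<open>The zeta function near \<open>\<rho>\<close>\<close>

lemma summable_zeta:
  assumes "s > 1"
  shows "summable (\<lambda>n. real (Suc n) powr -s)"
  using assms summable_real_powr_iff[of "-s"] summable_Suc_iff[of "\<lambda>n. real n powr -s"] by simp

lemma zeta_eq: "zeta s = (\<Sum>n. real (Suc n) powr -s)"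
  by (simp add: zeta_def powr_minus_divide)

lemma sum_le_zeta:
  assumes "s > 1" "finite A" "0 \<notin> A"
  shows "(\<Sum>x\<in>A. real x powr -s) \<le> zeta s"
proof -
  have Suc: "Suc (x - 1) = x" if "x \<in> A" for x
    using that assms(3) by (cases x) auto
  have inj: "inj_on (\<lambda>x. x - 1) A"
    by (intro inj_onI) (metis Suc)
  have "(\<Sum>x\<in>A. real x powr -s) = (\<Sum>x\<in>A. real (Suc (x - 1)) powr -s)"
    by (intro sum.cong refl) (simp only: Suc)
  also have "\<dots> = (\<Sum>n\<in>(\<lambda>x. x - 1) ` A. real (Suc n) powr -s)"
    using inj by (simp only: sum.reindex o_def)
  also have "\<dots> \<le> zeta s"
    unfolding zeta_eq using assms by (intro sum_le_suminf summable_zeta) auto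
  finally show ?thesis .
qed

lemma sum_ge_zeta_eventually:
  assumes "s > 1" "c < zeta s"
  shows "\<forall>\<^sub>F X in sequentially. (\<Sum>x=1..X. real x powr -s) > c"
proof -
  have "(\<lambda>X. \<Sum>n<X. real (Suc n) powr -s) \<longlonglongrightarrow> zeta s"
    unfolding zeta_eq using assms by (intro summable_LIMSEQ summable_zeta)
  then have "\<forall>\<^sub>F X in sequentially. (\<Sum>n<X. real (Suc n) powr -s) > c"
    using assms by (intro order_tendstoD(1))
  moreover have "(\<Sum>n<X. real (Suc n) powr -s) = (\<Sum>x=1..X. real x powr -s)" for X
    by (simp only: sum.atLeast1_atMost_eq One_nat_def)
  ultimately show ?thesis by simp
qed

text \<open>Comparing only the terms of index \<open>2\<close> is a substitute for the derivative of \<open>\<zeta>\<close>; it suffices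
for strict monotonicity and for linear estimates near \<open>\<rho>\<close>.\<close>

lemma zeta_diff_ge:
  assumes "1 < s" "s \<le> t"
  shows "zeta s - zeta t \<ge> 2 powr -s - 2 powr -t"
proof -
  have "zeta s - zeta t = (\<Sum>n. real (Suc n) powr -s - real (Suc n) powr -t)"
    unfolding zeta_eq using assms by (intro suminf_diff summable_zeta) auto
  also have "\<dots> \<ge> (\<Sum>n\<in>{1}. real (Suc n) powr -s - real (Suc n) powr -t)"
    using assms by (intro sum_le_suminf summable_diff summable_zeta) (auto intro!: powr_mono)
  finally show ?thesis by simp
qed

lemma zeta_strict_antimono:
  assumes "1 < s" "s < t"
  shows "zeta t < zeta s"
proof -
  have "(2::real) powr -t < 2 powr -s" using assms by (intro powr_less_mono) auto
  moreover have "zeta s - zeta t \<ge> 2 powr -s - 2 powr -t" using assms by (intro zeta_diff_ge) auto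
  ultimately show ?thesis by linarith
qed

text \<open>Convexity provides continuity, hence the existence of \<open>\<rho>\<close>, and also the upper estimate for
\<open>\<zeta>\<close> to the left of \<open>\<rho>\<close>, as a chord lies above the graph.\<close>

lemma convex_on_zeta: "convex_on {1<..} zeta"
proof (rule convex_onI)
  fix t s r :: real assume t: "0 < t" "t < 1" and sr: "s \<in> {1<..}" "r \<in> {1<..}"
  have eq: "(1 - t) *\<^sub>R s + t *\<^sub>R r = (1 - t) * s + t * r" by simp
  have cv: "(1 - t) * s + t * r > 1"
    using sr t convexD[OF convex_real_interval(3)[of 1], of s r "1 - t" t] by auto
  have "zeta ((1 - t) * s + t * r)
      \<le> (\<Sum>n. (1 - t) * real (Suc n) powr -s + t * real (Suc n) powr -r)"
    unfolding zeta_eq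
  proof (intro suminf_le summable_zeta summable_add summable_mult)
    fix n :: nat
    define l where "l = ln (real (Suc n))"
    have *: "real (Suc n) powr -x = exp (- x * l)" for x by (simp add: powr_def l_def)
    have "exp ((1 - t) *\<^sub>R (-s * l) + t *\<^sub>R (-r * l)) \<le> (1 - t) * exp (-s * l) + t * exp (-r * l)"
      using t by (intro convex_onD[OF exp_convex]) auto
    then show "real (Suc n) powr - ((1 - t) * s + t * r)
        \<le> (1 - t) * real (Suc n) powr -s + t * real (Suc n) powr -r"
      unfolding * by (simp add: algebra_simps)
  qed (use sr cv in auto)
  also have "\<dots> = (1 - t) * zeta s + t * zeta r"
    unfolding zeta_eq using sr
    by (intro sums_unique[symmetric] sums_add sums_mult summable_sums summable_zeta) auto
  finally show "zeta ((1 - t) *\<^sub>R s + t *\<^sub>R r) \<le> (1 - t) * zeta s + t * zeta r"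
    unfolding eq .
qed auto

text \<open>Intermediate values: \<open>1 + 1/2 + 1/3 + 1/4 > 2\<close> bounds \<open>\<zeta>\<close> from below near \<open>1\<close>, and
\<open>\<zeta>(2) = \<pi>\<^sup>2 / 6 < 2\<close>.\<close>

lemma zeta_eq_2_exists: "\<exists>s>1. zeta s = 2"
proof -
  have "((\<lambda>s. \<Sum>x\<in>{1..4::nat}. real x powr -s) \<longlongrightarrow> (\<Sum>x\<in>{1..4::nat}. real x powr -1)) (at_right 1)"
    by (intro tendsto_intros) auto
  moreover have "(\<Sum>x\<in>{1..4::nat}. real x powr -1) > 2"
    by (simp add: numeral_eq_Suc powr_minus_divide)
  ultimately have "\<forall>\<^sub>F s in at_right 1. (\<Sum>x\<in>{1..4::nat}. real x powr -s) > 2"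
    by (rule order_tendstoD)
  moreover have "\<forall>\<^sub>F s in at_right (1::real). s < 2"
    by (rule eventually_at_right_real[THEN eventually_mono]) auto
  moreover have "\<forall>\<^sub>F s in at_right (1::real). s > 1" by (simp add: eventually_at_right_less)
  ultimately have "\<forall>\<^sub>F s in at_right 1. (\<Sum>x\<in>{1..4::nat}. real x powr -s) > 2 \<and> s < 2 \<and> s > 1"
    by eventually_elim auto
  then obtain a where a: "(\<Sum>x\<in>{1..4::nat}. real x powr -a) > 2" "a < 2" "1 < a"
    using eventually_happens'[of "at_right (1::real)"] by force
  have "zeta a > 2" using a sum_le_zeta[of a "{1..4}"] by simp
  moreover have "zeta 2 < 2"
  proof -
    have "real (Suc n) powr -2 = 1 / real ((n + 1)\<^sup>2)" for n
      unfolding powr_minus_divide by (subst powr_numeral) (auto simp: add.commute)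
    then have "zeta 2 = pi\<^sup>2 / 6"
      using inverse_squares_sums unfolding zeta_eq sums_iff by (simp only:)
    moreover have "pi * pi \<le> 3.2 * 3.2" using pi_approx by (intro mult_mono) auto
    ultimately show ?thesis unfolding power2_eq_square by linarith
  qed
  moreover have "continuous_on {a..2} zeta"
    by (rule continuous_on_subset[OF convex_on_continuous[OF _ convex_on_zeta]]) (use a(3) in auto)
  ultimately obtain s where "a \<le> s" "s \<le> 2" "zeta s = 2"
    using IVT2'[of zeta 2 2 a] a(2) by (metis less_imp_le)
  then show ?thesis using a(3) by (intro exI[of _ s]) simp
qed

lemma kalmar_rho: "kalmar_rho > 1" "zeta kalmar_rho = 2"
proof -
  obtain s where s: "s > 1" "zeta s = 2" using zeta_eq_2_exists by blast
  have "kalmar_rho > 1 \<and> zeta kalmar_rho = 2"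
    unfolding kalmar_rho_def
  proof (rule theI)
    show "s > 1 \<and> zeta s = 2" using s by blast
    show "t = s" if "t > 1 \<and> zeta t = 2" for t
      using that s zeta_strict_antimono[of t s] zeta_strict_antimono[of s t] by linarith
  qed
  then show "kalmar_rho > 1" "zeta kalmar_rho = 2" by auto
qed

lemma zeta_left_upper:
  "\<exists>B>0. \<exists>d1>0. d1 < kalmar_rho - 1 \<and> (\<forall>d. 0 \<le> d \<longrightarrow> d \<le> d1 \<longrightarrow> zeta (kalmar_rho - d) \<le> 2 + B * d)"
proof -
  define d1 where "d1 = (kalmar_rho - 1) / 2"
  have d1: "d1 > 0" "d1 < kalmar_rho - 1" using kalmar_rho by (auto simp: d1_def)
  define B where "B = (zeta (kalmar_rho - d1) - 2) / d1"
  have "zeta (kalmar_rho - d1) > 2" using zeta_strict_antimono[of "kalmar_rho - d1" kalmar_rho] d1 kalmar_rho by simp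
  then have "B > 0" using d1 by (simp add: B_def)
  moreover have "zeta (kalmar_rho - d) \<le> 2 + B * d" if "0 \<le> d" "d \<le> d1" for d
  proof -
    have "zeta ((1 - d / d1) *\<^sub>R kalmar_rho + (d / d1) *\<^sub>R (kalmar_rho - d1))
        \<le> (1 - d / d1) * zeta kalmar_rho + (d / d1) * zeta (kalmar_rho - d1)"
      using that d1 kalmar_rho by (intro convex_onD[OF convex_on_zeta]) auto
    moreover have "(1 - d / d1) *\<^sub>R kalmar_rho + (d / d1) *\<^sub>R (kalmar_rho - d1) = kalmar_rho - d"
      using d1 by (simp add: field_simps)
    moreover have "(1 - d / d1) * 2 + (d / d1) * zeta (kalmar_rho - d1) = 2 + B * d"
      using d1 by (simp add: B_def field_simps)
    ultimately show ?thesis using kalmar_rho by simp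
  qed
  ultimately show ?thesis using d1 by blast
qed

lemma zeta_right_upper:
  assumes "0 \<le> d" "d \<le> 1"
  shows "zeta (kalmar_rho + d) \<le> 2 - 2 powr -kalmar_rho / 2 * d"
proof -
  have "exp ((1 - d) *\<^sub>R 0 + d *\<^sub>R (- ln 2)) \<le> (1 - d) * exp 0 + d * exp (- ln 2 :: real)"
    using assms by (intro convex_onD[OF exp_convex]) auto
  then have "2 powr -d \<le> 1 - d / 2" by (simp add: powr_def exp_minus)
  then have "2 powr -kalmar_rho * 2 powr -d \<le> 2 powr -kalmar_rho * (1 - d / 2)"
    by (intro mult_left_mono) auto
  then have "2 powr -(kalmar_rho + d) \<le> 2 powr -kalmar_rho - 2 powr -kalmar_rho / 2 * d"
    by (simp add: powr_add[symmetric] algebra_simps)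
  then show ?thesis using zeta_diff_ge[of kalmar_rho "kalmar_rho + d"] kalmar_rho assms by simp
qed

lemma zeta_left_lower:
  assumes "0 \<le> d" "d < kalmar_rho - 1"
  shows "zeta (kalmar_rho - d) \<ge> 2 + 2 powr -kalmar_rho * ln 2 * d"
proof -
  have "1 + d * ln 2 \<le> 2 powr d" using exp_ge_add_one_self[of "d * ln 2"] by (simp add: powr_def)
  then have "2 powr -kalmar_rho * (1 + d * ln 2) \<le> 2 powr -kalmar_rho * 2 powr d"
    by (intro mult_left_mono) auto
  also have "\<dots> = 2 powr -(kalmar_rho - d)" by (simp add: powr_add[symmetric])
  finally show ?thesis
    using zeta_diff_ge[of "kalmar_rho - d" kalmar_rho] kalmar_rho assms by (simp add: algebra_simps)
qed

section \<open>Mertens' estimate and the primes in \<open>(y, B y]\<close>\<close>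

lemma ln_eq_sum_multiplicity:
  assumes "1 \<le> x" "x \<le> n"
  shows "ln (real x) = (\<Sum>p | prime p \<and> p \<le> n. real (multiplicity p x) * ln (real p))"
proof -
  have pos: "\<And>p. p \<in> prime_factors x \<Longrightarrow> real p > 0" by (auto simp: prime_factors_gt_0_nat)
  have "real x = (\<Prod>p\<in>prime_factors x. real p ^ multiplicity p x)"
    using arg_cong[OF prime_factorization_nat[of x], of real] assms by simp
  then have "ln (real x) = (\<Sum>p\<in>prime_factors x. ln (real p ^ multiplicity p x))"
    using pos by (simp add: ln_prod)
  also have "\<dots> = (\<Sum>p\<in>prime_factors x. real (multiplicity p x) * ln (real p))"
    using pos by (intro sum.cong) (auto simp: ln_realpow)
  also have "\<dots> = (\<Sum>p | prime p \<and> p \<le> n. real (multiplicity p x) * ln (real p))"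
  proof (rule sum.mono_neutral_left)
    show "prime_factors x \<subseteq> {p. prime p \<and> p \<le> n}"
    proof
      fix p assume "p \<in> prime_factors x"
      then have "prime p" "p dvd x" by auto
      then show "p \<in> {p. prime p \<and> p \<le> n}" using dvd_imp_le[of p x] assms by auto
    qed
    show "\<forall>i\<in>{p. prime p \<and> p \<le> n} - prime_factors x. real (multiplicity i x) * ln (real i) = 0"
      using assms by (auto simp: prime_factors_multiplicity)
  qed auto
  finally show ?thesis .
qed

text \<open>Legendre's formula, with the exponent of \<open>p\<close> in the factorial left as a sum of multiplicities.\<close>

lemma ln_fact_eq:
  "ln (fact n) = (\<Sum>p | prime p \<and> p \<le> n. ln (real p) * (\<Sum>x=1..n. real (multiplicity p x)))"
proof -
  have "fact n = (\<Prod>x=1..n. real x)" by (simp add: fact_prod)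
  then have "ln (fact n :: real) = (\<Sum>x=1..n. ln (real x))"
    by (simp only:) (rule ln_prod, auto)
  also have "\<dots> = (\<Sum>x=1..n. \<Sum>p | prime p \<and> p \<le> n. real (multiplicity p x) * ln (real p))"
    by (intro sum.cong ln_eq_sum_multiplicity) auto
  also have "\<dots> = (\<Sum>p | prime p \<and> p \<le> n. \<Sum>x=1..n. real (multiplicity p x) * ln (real p))"
    by (rule sum.swap)
  finally show ?thesis by (simp add: sum_distrib_left mult.commute)
qed

text \<open>Induction on \<open>X\<close>: with \<open>q = X div p\<close>, the sum up to \<open>X\<close> is \<open>q\<close> plus the sum up to \<open>q\<close>, and
\<open>(p - 1) q + q = p q \<le> X\<close>.\<close>

lemma sum_multiplicity_le:
  assumes "prime p"
  shows "real (p - 1) * (\<Sum>x=1..X. real (multiplicity p x)) \<le> real X"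
proof (induction X rule: less_induct)
  case (less X)
  show ?case
  proof (cases "X = 0")
    case False
    define q where "q = X div p"
    have p: "p > 1" using assms by (rule prime_gt_1_nat)
    have "(\<Sum>x=1..X. real (multiplicity p x)) = (\<Sum>x=1..q. 1 + real (multiplicity p x))"
      using sum_multiplicity[OF assms, of "\<lambda>_. 1"] by (simp add: q_def)
    also have "\<dots> = real q + (\<Sum>x=1..q. real (multiplicity p x))"
      by (simp add: sum.distrib)
    finally have "real (p - 1) * (\<Sum>x=1..X. real (multiplicity p x))
       = real (p - 1) * real q + real (p - 1) * (\<Sum>x=1..q. real (multiplicity p x))"
      by (simp only: distrib_left)
    also have "real (p - 1) * (\<Sum>x=1..q. real (multiplicity p x)) \<le> real q"
      using False p by (intro less) (auto simp: q_def)
    also have "real (p - 1) * real q + real q = real (p * q)"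
      using p by (simp add: of_nat_diff algebra_simps)
    also have "\<dots> \<le> real X" unfolding q_def of_nat_le_iff by simp
    finally show ?thesis by simp
  qed auto
qed

lemma sum_multiplicity_ge:
  assumes "prime p"
  shows "(\<Sum>x=1..X. real (multiplicity p x)) \<ge> real X / real p - 1"
proof -
  have "real X / real p - 1 \<le> real (X div p)"
  proof -
    have "X < p + p * (X div p)" using dividend_less_div_times[of p X] assms
      by (simp add: prime_gt_0_nat mult.commute)
    then have "real X < real p + real p * real (X div p)"
      by (metis of_nat_add of_nat_less_iff of_nat_mult)
    then show ?thesis using assms by (simp add: field_simps prime_gt_0_nat)
  qed
  also have "\<dots> = (\<Sum>x=1..X div p. 1)" by simp
  also have "\<dots> \<le> (\<Sum>x=1..X div p. 1 + real (multiplicity p x))" by (intro sum_mono) auto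
  also have "\<dots> = (\<Sum>x=1..X. real (multiplicity p x))"
    using sum_multiplicity[OF assms, of "\<lambda>_. 1" X] by simp
  finally show ?thesis .
qed

lemma power_div_fact_le_exp:
  fixes x :: real
  assumes "x \<ge> 0"
  shows "x ^ n / fact n \<le> exp x"
proof -
  have "(\<Sum>k\<in>{n}. x ^ k /\<^sub>R fact k) \<le> (\<Sum>k. x ^ k /\<^sub>R fact k)"
    using assms by (intro sum_le_suminf sums_summable[OF exp_converges]) auto
  then show ?thesis using sums_unique[OF exp_converges[of x]] by (simp add: divide_inverse mult.commute)
qed

text \<open>Compares \<open>ln n! \<le> n ln n\<close> with Legendre's formula, where \<open>p\<close> has exponent at least \<open>n/p - 1\<close>; the
total rounding error is the Chebyshev sum.\<close>

lemma mertens_upper: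
  assumes "n \<ge> 1"
  shows "(\<Sum>p | prime p \<and> p \<le> n. ln (real p) / real p) \<le> ln (real n) + ln 4"
proof -
  let ?P = "{p. prime p \<and> p \<le> n}"
  have "real n * (\<Sum>p\<in>?P. ln (real p) / real p) - (\<Sum>p\<in>?P. ln (real p))
      = (\<Sum>p\<in>?P. ln (real p) * (real n / real p - 1))"
    by (simp add: sum_distrib_left sum_subtractf algebra_simps)
  also have "\<dots> \<le> ln (fact n)"
    unfolding ln_fact_eq
    by (intro sum_mono mult_left_mono sum_multiplicity_ge) (auto dest: prime_ge_1_nat)
  also have "\<dots> \<le> ln (real n ^ n)"
    using assms fact_le_power[of n] by (subst ln_le_cancel_iff) (auto simp flip: of_nat_power)
  also have "\<dots> = real n * ln (real n)" using assms by (simp add: ln_realpow)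
  finally have "real n * (\<Sum>p\<in>?P. ln (real p) / real p) \<le> real n * ln (real n) + ln 4 * real n"
    using sum_ln_primes_le[of n] by linarith
  then have "real n * (\<Sum>p\<in>?P. ln (real p) / real p) \<le> real n * (ln (real n) + ln 4)"
    by (simp add: algebra_simps)
  then show ?thesis using assms by (subst (asm) mult_le_cancel_left_pos) auto
qed

text \<open>Compares \<open>ln n! \<ge> n ln n - n\<close> with Legendre's formula, where \<open>p\<close> has exponent at most \<open>n/(p-1)\<close>.
Replacing \<open>p - 1\<close> by \<open>p\<close> costs a convergent sum, which is compared with \<open>\<zeta>(3/2)\<close>.\<close>

lemma mertens_lower:
  assumes "n \<ge> 1"
  shows "(\<Sum>p | prime p \<and> p \<le> n. ln (real p) / real p) \<ge> ln (real n) - 1 - 4 * zeta (3/2)"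
proof -
  let ?P = "{p. prime p \<and> p \<le> n}"
  have pm: "real (p - 1) = real p - 1" "real p \<ge> 2" "ln (real p) \<ge> 0" if "p \<in> ?P" for p
    using that prime_ge_2_nat[of p] by (auto simp: of_nat_diff)
  have "real n * ln (real n) - real n \<le> ln (fact n)"
  proof -
    have "ln (real n ^ n / fact n) \<le> ln (exp (real n))"
      using assms power_div_fact_le_exp[of "real n" n] by (subst ln_le_cancel_iff) auto
    then show ?thesis using assms by (simp add: ln_div ln_realpow)
  qed
  also have "ln (fact n) \<le> (\<Sum>p\<in>?P. ln (real p) * (real n / (real p - 1)))"
    unfolding ln_fact_eq
  proof (intro sum_mono mult_left_mono)
    fix p assume p: "p \<in> ?P"
    show "(\<Sum>x=1..n. real (multiplicity p x)) \<le> real n / (real p - 1)"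
      using sum_multiplicity_le[of p n] p pm[OF p] by (simp add: pos_le_divide_eq mult.commute)
  qed (use pm in auto)
  also have "\<dots> = real n * (\<Sum>p\<in>?P. ln (real p) / (real p - 1))"
    by (simp add: sum_distrib_left mult_ac)
  finally have "real n * (ln (real n) - 1) \<le> real n * (\<Sum>p\<in>?P. ln (real p) / (real p - 1))"
    by (simp add: algebra_simps)
  then have "ln (real n) - 1 \<le> (\<Sum>p\<in>?P. ln (real p) / (real p - 1))"
    using assms by (subst (asm) mult_le_cancel_left_pos) auto
  also have "\<dots> \<le> (\<Sum>p\<in>?P. ln (real p) / real p + 4 * real p powr -(3/2))"
  proof (intro sum_mono)
    fix p assume p: "p \<in> ?P"
    define r where "r = real p"
    have r: "r \<ge> 2" using pm[OF p] by (simp add: r_def)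
    have "ln r = 2 * ln (sqrt r)" using r by (simp add: ln_sqrt)
    also have "\<dots> \<le> 2 * sqrt r" using r ln_le_minus_one[of "sqrt r"] by simp
    finally have "ln r / (r * (r - 1)) \<le> 2 * sqrt r / (r * (r / 2))"
      using r by (intro frac_le mult_left_mono mult_pos_pos) auto
    also have "\<dots> = 4 * (r powr (1/2) / r powr 2)" using r by (simp add: powr_half_sqrt power2_eq_square)
    also have "\<dots> = 4 * r powr -(3/2)" by (subst powr_diff[symmetric]) simp
    finally have "ln r / (r * (r - 1)) \<le> 4 * r powr -(3/2)" .
    moreover have "ln r / (r - 1) = ln r / r + ln r / (r * (r - 1))"
      using r by (simp add: field_simps)
    ultimately show "ln (real p) / (real p - 1) \<le> ln (real p) / real p + 4 * real p powr -(3/2)"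
      by (simp add: r_def)
  qed
  also have "\<dots> = (\<Sum>p\<in>?P. ln (real p) / real p) + 4 * (\<Sum>p\<in>?P. real p powr -(3/2))"
    by (simp add: sum.distrib sum_distrib_left)
  also have "(\<Sum>p\<in>?P. real p powr -(3/2)) \<le> zeta (3/2)"
    by (intro sum_le_zeta) auto
  finally show ?thesis by simp
qed

text \<open>By the two Mertens estimates, \<open>\<Sum>ln p / p\<close> over the primes in the interval is \<open>ln B\<close> up to a bounded
error, hence at least \<open>1\<close> for a suitable \<open>B\<close>, while each summand is at most \<open>2 ln y / y\<close>.\<close>

lemma many_primes_in_interval:
  "\<exists>B>1. \<forall>\<^sub>F y in at_top. real (card {p::nat. prime p \<and> y < real p \<and> real p \<le> B * y}) \<ge> y / (2 * ln y)"
proof -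
  define K where "K = 1 + 4 * zeta (3/2) + ln 8"
  \<comment> \<open>The errors in the Mertens estimates and in rounding \<open>y\<close> and \<open>B y\<close> add up to at most \<open>K\<close>.\<close>
  define B where "B = exp (K + 1)"
  have "zeta (3/2) \<ge> 0" using sum_le_zeta[of "3/2" "{}"] by simp
  then have K: "K \<ge> 1" by (simp add: K_def)
  have B: "B > 1" "ln B = K + 1" using K by (auto simp: B_def)
  have "\<forall>\<^sub>F y in at_top. real (card {p::nat. prime p \<and> y < real p \<and> real p \<le> B * y}) \<ge> y / (2 * ln y)"
    using eventually_ge_at_top[of "B + 1"]
  proof eventually_elim
    case (elim y)
    then have y: "y > 1" "y \<ge> B" using B by linarith+
    define m where "m = nat \<lfloor>y\<rfloor>"
    define n where "n = nat \<lfloor>B * y\<rfloor>"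
    have By: "y \<le> B * y" using B y by (simp add: mult_le_cancel_right1)
    have m: "m \<ge> 1" "real m \<le> y" using y by (auto simp: m_def of_nat_floor le_nat_iff)
    have n: "n \<ge> 1" "real n \<ge> B * y / 2" "real n \<le> B * y"
    proof -
      have "B * y > 1" using y By by linarith
      then have "\<lfloor>B * y\<rfloor> \<ge> 1" "real n = real_of_int \<lfloor>B * y\<rfloor>" by (auto simp: n_def)
      then show "n \<ge> 1" "real n \<ge> B * y / 2" "real n \<le> B * y" by linarith+
    qed
    have mn: "m \<le> n" unfolding m_def n_def using By by (intro nat_mono floor_mono)
    let ?S = "{p::nat. prime p \<and> y < real p \<and> real p \<le> B * y}"
    have S: "?S = {p. prime p \<and> p \<le> n} - {p. prime p \<and> p \<le> m}"
      using y By by (auto simp: m_def n_def le_nat_floor nat_floor_neg le_nat_iff le_floor_iff)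
    have fin: "finite ?S" unfolding S by auto
    have "(\<Sum>p\<in>?S. ln (real p) / real p) =
        (\<Sum>p | prime p \<and> p \<le> n. ln (real p) / real p) - (\<Sum>p | prime p \<and> p \<le> m. ln (real p) / real p)"
      unfolding S using mn by (intro sum_diff) auto
    also have "\<dots> \<ge> (ln (real n) - 1 - 4 * zeta (3/2)) - (ln (real m) + ln 4)"
      by (intro diff_mono mertens_lower mertens_upper n m)
    finally have *: "(ln (real n) - 1 - 4 * zeta (3/2)) - (ln (real m) + ln 4) \<le> (\<Sum>p\<in>?S. ln (real p) / real p)" .
    have "ln (real n) \<ge> ln (B * y / 2)" using n y B by (subst ln_le_cancel_iff) auto
    moreover have "ln (B * y / 2) = ln B + ln y - ln 2" using B y by (simp add: ln_mult ln_div)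
    moreover have "ln (real m) \<le> ln y" using m y by (subst ln_le_cancel_iff) auto
    moreover have "ln 8 = ln 4 + ln (2::real)" by (subst ln_mult_pos[symmetric]) auto
    ultimately have "1 \<le> (\<Sum>p\<in>?S. ln (real p) / real p)"
      using * B by (simp add: K_def)
    also have "\<dots> \<le> (\<Sum>p\<in>?S. 2 * ln y / y)"
    proof (intro sum_mono frac_le)
      fix p assume p: "p \<in> ?S"
      have "ln (real p) \<le> ln (y * y)"
      proof (subst ln_le_cancel_iff)
        have "real p \<le> B * y" using p by simp
        also have "\<dots> \<le> y * y" using y by (intro mult_right_mono) auto
        finally show "real p \<le> y * y" .
      qed (use p y in auto)
      then show "ln (real p) \<le> 2 * ln y" using y by (simp add: ln_mult)
    qed (use y in auto)
    also have "\<dots> = real (card ?S) * (2 * ln y / y)" by simp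
    finally show ?case using y by (simp add: field_simps)
  qed
  then show ?thesis using B by blast
qed

section \<open>The recursion for the Kalmar function\<close>

text \<open>Unlike \<open>ordered_factorizations\<close>, the empty product is allowed: this accounts for the value
\<open>K(1) = 1\<close> and makes the recursion uniform.\<close>

definition factorization_lists :: "nat \<Rightarrow> nat list set" where
  "factorization_lists n = {xs. (\<forall>x\<in>set xs. 2 \<le> x) \<and> prod_list xs = n}"

lemma factorization_lists_1: "factorization_lists 1 = {[]}"
proof -
  have "xs = []" if "\<forall>x\<in>set xs. 2 \<le> x" "prod_list xs = (1::nat)" for xs
    using that by (cases xs) auto
  then show ?thesis by (auto simp: factorization_lists_def)
qed

lemma kalmar_eq_card:
  assumes "n \<ge> 1"
  shows "kalmar n = card (factorization_lists n)"
proof (cases "n = 1")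
  case True
  then show ?thesis using factorization_lists_1 by (simp add: kalmar_def)
next
  case False
  then have "ordered_factorizations n = factorization_lists n"
    by (auto simp: ordered_factorizations_def factorization_lists_def)
  then show ?thesis using False by (simp add: kalmar_def)
qed

lemma factorization_lists_rec:
  assumes "n \<ge> 2"
  shows "factorization_lists n = (\<Union>d\<in>{d. d dvd n \<and> 2 \<le> d}. (#) d ` factorization_lists (n div d))"
proof (intro equalityI subsetI)
  fix xs assume xs: "xs \<in> factorization_lists n"
  then obtain d ys where "xs = d # ys" "2 \<le> d" "n = d * prod_list ys" "\<forall>x\<in>set ys. 2 \<le> x"
    using assms by (cases xs) (auto simp: factorization_lists_def)
  then show "xs \<in> (\<Union>d\<in>{d. d dvd n \<and> 2 \<le> d}. (#) d ` factorization_lists (n div d))"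
    by (intro UN_I[of d] image_eqI[of _ _ ys]) (auto simp: factorization_lists_def)
qed (auto simp: factorization_lists_def)

lemma finite_factorization_lists: "n \<ge> 1 \<Longrightarrow> finite (factorization_lists n)"
proof (induction n rule: less_induct)
  case (less n)
  show ?case
  proof (cases "n = 1")
    case False
    then have "n \<ge> 2" using less.prems by simp
    show ?thesis
      unfolding factorization_lists_rec[OF \<open>n \<ge> 2\<close>]
    proof (intro finite_UN_I finite_imageI less.IH)
      show "finite {d. d dvd n \<and> 2 \<le> d}"
        using less.prems by (intro finite_subset[OF _ finite_divisors_nat[of n]]) auto
    qed (use less.prems in \<open>auto elim!: dvdE\<close>)
  qed (simp add: factorization_lists_1[simplified])
qed

text \<open>Splits off the first factor \<open>d\<close>.\<close>

lemma kalmar_rec: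
  assumes "n \<ge> 2"
  shows "kalmar n = (\<Sum>d | d dvd n \<and> 2 \<le> d. kalmar (n div d))"
proof -
  have quot: "n div d \<ge> 1" if "d dvd n" for d
    using that assms dvd_mult_div_cancel[OF that] by (cases "n div d") auto
  have fin: "finite {d. d dvd n \<and> 2 \<le> d}"
    using assms by (intro finite_subset[OF _ finite_divisors_nat[of n]]) auto
  have "kalmar n = (\<Sum>d | d dvd n \<and> 2 \<le> d. card ((#) d ` factorization_lists (n div d)))"
    using assms fin quot
    by (subst kalmar_eq_card, simp, subst factorization_lists_rec, simp, subst card_UN_disjoint)
      (auto intro!: finite_imageI finite_factorization_lists)
  also have "\<dots> = (\<Sum>d | d dvd n \<and> 2 \<le> d. kalmar (n div d))"
    using quot by (intro sum.cong refl) (auto simp: card_image kalmar_eq_card)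
  finally show ?thesis .
qed

lemma kalmar_pos:
  assumes "n \<ge> 1"
  shows "kalmar n \<ge> 1"
proof -
  have "(if n = 1 then [] else [n]) \<in> factorization_lists n"
    using assms by (auto simp: factorization_lists_def)
  then have "card (factorization_lists n) > 0"
    using assms finite_factorization_lists by (auto simp: card_gt_0_iff)
  then show ?thesis using assms by (simp add: kalmar_eq_card)
qed

section \<open>Upper bound\<close>

text \<open>Comparison principle for the recursion. Only the divisors of \<open>n\<close> matter, so \<open>G\<close> may
exploit the arithmetic of \<open>n\<close>.\<close>

lemma kalmar_le_supersolution:
  fixes G :: "nat \<Rightarrow> real"
  assumes "n \<ge> 1" "G 1 \<ge> 1"
    and "\<And>m. m dvd n \<Longrightarrow> m \<ge> 2 \<Longrightarrow> (\<Sum>d | d dvd m \<and> 2 \<le> d. G (m div d)) \<le> G m"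
  shows "real (kalmar n) \<le> G n"
proof -
  have "real (kalmar m) \<le> G m" if "m dvd n" for m
    using that
  proof (induction m rule: less_induct)
    case (less m)
    have "m \<ge> 1" using less.prems assms(1) by (auto elim!: dvdE)
    show ?case
    proof (cases "m = 1")
      case True
      then show ?thesis using assms(2) by (simp add: kalmar_def)
    next
      case False
      with \<open>m \<ge> 1\<close> have "m \<ge> 2" by simp
      then have "real (kalmar m) = (\<Sum>d | d dvd m \<and> 2 \<le> d. real (kalmar (m div d)))"
        by (simp add: kalmar_rec)
      also have "\<dots> \<le> (\<Sum>d | d dvd m \<and> 2 \<le> d. G (m div d))"
      proof (intro sum_mono less.IH)
        fix d assume d: "d \<in> {d. d dvd m \<and> 2 \<le> d}"
        then show "m div d < m" using \<open>m \<ge> 1\<close> by auto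
        have "m div d dvd m" using d by (auto elim!: dvdE)
        then show "m div d dvd n" using less.prems by (rule dvd_trans)
      qed
      also have "\<dots> \<le> G m" using \<open>m \<ge> 2\<close> less.prems by (intro assms(3))
      finally show ?thesis .
    qed
  qed
  then show ?thesis by simp
qed

lemma powr_div_eq:
  assumes "d dvd m" "d > (0::nat)"
  shows "real (m div d) powr s = real m powr s * real d powr -s"
  using assms by (auto simp: real_of_nat_div powr_divide powr_minus_divide)

text \<open>No element of \<open>P\<close> occurs as a factor of a divisor of \<open>n\<close>, so those terms may be subtracted
from \<open>\<zeta>(s)\<close>. For \<open>P = {}\<close> and \<open>s = \<rho>\<close> this is the basic bound \<open>K(n) \<le> n\<^bsup>\<rho>\<^esup>\<close>.\<close>

lemma kalmar_le_of_coprime_primes: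
  assumes "n \<ge> 1" "finite P" "\<And>p. p \<in> P \<Longrightarrow> prime p \<and> \<not> p dvd n"
    and s: "s > 1" "zeta s - (\<Sum>p\<in>P. real p powr -s) \<le> 2"
  shows "real (kalmar n) \<le> real n powr s"
proof (rule kalmar_le_supersolution)
  fix m assume m: "m dvd n" "m \<ge> 2"
  let ?D = "{d. d dvd m \<and> 2 \<le> d}"
  have fin: "finite ?D" using m by (intro finite_subset[OF _ finite_divisors_nat[of m]]) auto
  have disj: "P \<inter> insert 1 ?D = {}" using assms(3) m by (auto dest: dvd_trans)
  have "(\<Sum>x\<in>P \<union> insert 1 ?D. real x powr -s) \<le> zeta s"
    using s assms(3) fin assms(2) by (intro sum_le_zeta) (auto dest: prime_gt_0_nat)
  also have "(\<Sum>x\<in>P \<union> insert 1 ?D. real x powr -s)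
      = (\<Sum>x\<in>P. real x powr -s) + (1 + (\<Sum>x\<in>?D. real x powr -s))"
    using fin assms(2) disj by (subst sum.union_disjoint) auto
  finally have *: "(\<Sum>x\<in>?D. real x powr -s) \<le> 1" using s by linarith
  have "(\<Sum>d\<in>?D. real (m div d) powr s) = real m powr s * (\<Sum>d\<in>?D. real d powr -s)"
    unfolding sum_distrib_left by (intro sum.cong refl powr_div_eq) auto
  also have "\<dots> \<le> real m powr s * 1" using * by (intro mult_left_mono) auto
  finally show "(\<Sum>d\<in>?D. real (m div d) powr s) \<le> real m powr s" by simp
qed (use assms in auto)

text \<open>The Euler product of \<open>2\<^bsup>w(x)\<^esup> x\<^bsup>-s\<^esup>\<close> is that of \<open>\<zeta>\<close> with the factor at each \<open>p \<in> P\<close> multiplied by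
\<open>1 + p\<^bsup>-s\<^esup>\<close>. The primes are added one at a time, each by splitting off its multiples.\<close>

lemma sum_pow2_prime_divisors_le:
  assumes "finite P" "\<And>p. p \<in> P \<Longrightarrow> prime p" "s > 1"
  shows "(\<Sum>x=1..X. 2 ^ card {p\<in>P. p dvd x} * real x powr -s) \<le> zeta s * (\<Prod>p\<in>P. 1 + real p powr -s)"
  using assms(1,2)
proof (induction P arbitrary: X rule: finite_induct)
  case empty
  then show ?case using sum_le_zeta[of s "{1..X}"] assms(3) by simp
next
  case (insert q P)
  define W where "W x = (2::real) ^ card {p\<in>P. p dvd x}" for x
  have q: "prime q" using insert by simp
  have W': "(2::real) ^ card {p\<in>insert q P. p dvd x} = W x + (if q dvd x then W x else 0)" for x
  proof (cases "q dvd x")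
    case True
    then have "{p\<in>insert q P. p dvd x} = insert q {p\<in>P. p dvd x}" by auto
    then show ?thesis using True insert.hyps by (simp add: W_def)
  next
    case False
    then have "{p\<in>insert q P. p dvd x} = {p\<in>P. p dvd x}" by auto
    then show ?thesis using False by (simp add: W_def)
  qed
  have Wq: "W (q * x) = W x" for x
  proof -
    have "\<not> p dvd q" if "p \<in> P" for p
      using that insert.hyps insert.prems q by (metis insertCI primes_dvd_imp_eq)
    then have "{p\<in>P. p dvd q * x} = {p\<in>P. p dvd x}"
      using insert.prems by (auto simp: prime_dvd_mult_iff)
    then show ?thesis by (simp add: W_def)
  qed
  have "(\<Sum>x=1..X. 2 ^ card {p\<in>insert q P. p dvd x} * real x powr -s)
      = (\<Sum>x=1..X. W x * real x powr -s) + (\<Sum>x=1..X. if q dvd x then W x * real x powr -s else 0)"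
    unfolding W' by (simp add: sum.distrib[symmetric] algebra_simps) (intro sum.cong refl, simp)
  also have "(\<Sum>x=1..X. if q dvd x then W x * real x powr -s else 0)
      = (\<Sum>x\<in>{x\<in>{1..X}. q dvd x}. W x * real x powr -s)"
    by (intro sum.inter_filter[symmetric]) auto
  also have "\<dots> = (\<Sum>x=1..X div q. W (q * x) * real (q * x) powr -s)"
    using q by (intro sum_multiples) (simp add: prime_gt_0_nat)
  also have "\<dots> = real q powr -s * (\<Sum>x=1..X div q. W x * real x powr -s)"
    unfolding Wq by (simp add: powr_mult sum_distrib_left mult_ac)
  also have "(\<Sum>x=1..X. W x * real x powr -s) \<le> zeta s * (\<Prod>p\<in>P. 1 + real p powr -s)"
    unfolding W_def using insert.prems by (intro insert.IH) auto
  also have "(\<Sum>x=1..X div q. W x * real x powr -s) \<le> zeta s * (\<Prod>p\<in>P. 1 + real p powr -s)"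
    unfolding W_def using insert.prems by (intro insert.IH) auto
  finally have "(\<Sum>x=1..X. 2 ^ card {p\<in>insert q P. p dvd x} * real x powr -s)
      \<le> zeta s * (\<Prod>p\<in>P. 1 + real p powr -s) + real q powr -s * (zeta s * (\<Prod>p\<in>P. 1 + real p powr -s))"
    by (simp add: mult_left_mono)
  then show ?case using insert.hyps by (simp add: algebra_simps)
qed

text \<open>Each prime of \<open>P\<close> divides at least one factor in every factorization of \<open>n\<close>. Giving a factor
weight \<open>2\<close> for each prime of \<open>P\<close> dividing it therefore multiplies the weight of a factorization by at
least \<open>2\<^bsup>card P\<^esup>\<close>.\<close>

lemma kalmar_le_of_prime_divisors:
  assumes "n \<ge> 1" "finite P" "\<And>p. p \<in> P \<Longrightarrow> prime p \<and> p dvd n"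
    and s: "s > 1" "zeta s * (\<Prod>p\<in>P. 1 + real p powr -s) \<le> 2"
  shows "real (kalmar n) \<le> real n powr s / 2 ^ card P"
proof -
  define W where "W x = card {p\<in>P. p dvd x}" for x
  have "{p\<in>P. p dvd 1} = {}" using assms(3) by (metis (lifting) Collect_empty_eq not_prime_unit)
  then have W1: "W 1 = 0" unfolding W_def by (simp only: card.empty)
  have "real (kalmar n) \<le> real n powr s / 2 ^ W n"
  proof (rule kalmar_le_supersolution)
    show "1 \<le> real 1 powr s / 2 ^ W 1" using W1 by simp
  next
    fix m assume m: "m dvd n" "m \<ge> 2"
    let ?D = "{d. d dvd m \<and> 2 \<le> d}"
    have W: "W m \<le> W (m div d) + W d" if "d dvd m" for d
    proof -
      have "{p\<in>P. p dvd m} \<subseteq> {p\<in>P. p dvd m div d} \<union> {p\<in>P. p dvd d}"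
      proof
        fix p assume p: "p \<in> {p\<in>P. p dvd m}"
        then have "prime p" "p dvd (m div d) * d" using assms(3) that by auto
        then show "p \<in> {p\<in>P. p dvd m div d} \<union> {p\<in>P. p dvd d}"
          using p by (auto simp: prime_dvd_mult_iff)
      qed
      then have "W m \<le> card ({p\<in>P. p dvd m div d} \<union> {p\<in>P. p dvd d})"
        unfolding W_def using assms(2) by (intro card_mono) auto
      also have "\<dots> \<le> W (m div d) + W d" unfolding W_def by (rule card_Un_le)
      finally show ?thesis .
    qed
    have fin: "finite ?D" using m by (intro finite_subset[OF _ finite_divisors_nat[of m]]) auto
    have "1 + (\<Sum>d\<in>?D. 2 ^ W d * real d powr -s) = (\<Sum>d\<in>insert 1 ?D. 2 ^ W d * real d powr -s)"
      using fin W1 by (subst sum.insert) auto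
    also have "\<dots> \<le> (\<Sum>d=1..m. 2 ^ W d * real d powr -s)"
      using m by (intro sum_mono2) (auto dest: dvd_imp_le)
    also have "\<dots> \<le> zeta s * (\<Prod>p\<in>P. 1 + real p powr -s)"
      unfolding W_def using assms by (intro sum_pow2_prime_divisors_le) auto
    finally have *: "(\<Sum>d\<in>?D. 2 ^ W d * real d powr -s) \<le> 1" using s by linarith
    have "(\<Sum>d\<in>?D. real (m div d) powr s / 2 ^ W (m div d))
        \<le> (\<Sum>d\<in>?D. real m powr s / 2 ^ W m * (2 ^ W d * real d powr -s))"
    proof (intro sum_mono)
      fix d assume d: "d \<in> ?D"
      have "(2::real) ^ W m \<le> 2 ^ W (m div d) * 2 ^ W d"
        using W[of d] d by (simp add: power_add[symmetric])
      then have "1 / 2 ^ W (m div d) \<le> (2::real) ^ W d / 2 ^ W m" by (simp add: field_simps)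
      then have "(real m powr s * real d powr -s) * (1 / 2 ^ W (m div d))
          \<le> (real m powr s * real d powr -s) * (2 ^ W d / 2 ^ W m)"
        by (intro mult_left_mono) auto
      then show "real (m div d) powr s / 2 ^ W (m div d) \<le> real m powr s / 2 ^ W m * (2 ^ W d * real d powr -s)"
        using d by (subst powr_div_eq) (auto simp: mult_ac)
    qed
    also have "\<dots> = real m powr s / 2 ^ W m * (\<Sum>d\<in>?D. 2 ^ W d * real d powr -s)"
      by (simp add: sum_distrib_left)
    also have "\<dots> \<le> real m powr s / 2 ^ W m * 1" using * by (intro mult_left_mono) auto
    finally show "(\<Sum>d\<in>?D. real (m div d) powr s / 2 ^ W (m div d)) \<le> real m powr s / 2 ^ W m" by simp
  qed (use assms in auto)
  moreover have "{p\<in>P. p dvd n} = P" using assms(3) by auto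
  ultimately show ?thesis by (simp add: W_def)
qed

text \<open>The linear bound on \<open>\<zeta>\<close> to the left of \<open>\<rho>\<close> turns the mass \<open>E\<close> of the excluded
primes into a decrease \<open>E / B\<close> of the exponent. Decreasing the exponent only
increases that mass, so \<open>E\<close> may be computed at \<open>\<rho>\<close>.\<close>

lemma ln_kalmar_le_of_coprime_primes:
  assumes "B > 0" and B: "\<And>d. 0 \<le> d \<Longrightarrow> d \<le> dmax \<Longrightarrow> zeta (kalmar_rho - d) \<le> 2 + B * d"
    and "dmax < kalmar_rho - 1"
    and n: "n \<ge> 1" "finite P" "\<And>p. p \<in> P \<Longrightarrow> prime p \<and> \<not> p dvd n"
    and E: "(\<Sum>p\<in>P. real p powr -kalmar_rho) \<le> B * dmax"
  shows "ln (real (kalmar n)) \<le> (kalmar_rho - (\<Sum>p\<in>P. real p powr -kalmar_rho) / B) * ln (real n)"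
proof -
  define E where "E = (\<Sum>p\<in>P. real p powr -kalmar_rho)"
  define s where "s = kalmar_rho - E / B"
  have E0: "E \<ge> 0" by (auto simp: E_def intro!: sum_nonneg)
  have d: "0 \<le> E / B" "E / B \<le> dmax" using E0 E \<open>B > 0\<close> by (auto simp: E_def field_simps)
  have "real (kalmar n) \<le> real n powr s"
  proof (rule kalmar_le_of_coprime_primes[OF n])
    show "s > 1" using d assms(3) by (simp add: s_def)
    have "E \<le> (\<Sum>p\<in>P. real p powr -s)"
      unfolding E_def using d n(3) prime_ge_1_nat by (intro sum_mono powr_mono) (auto simp: s_def)
    moreover have "zeta s \<le> 2 + E" using B[OF d] \<open>B > 0\<close> by (simp add: s_def)
    ultimately show "zeta s - (\<Sum>p\<in>P. real p powr -s) \<le> 2" by linarith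
  qed
  then have "ln (real (kalmar n)) \<le> ln (real n powr s)"
    using n(1) kalmar_pos[of n] by (subst ln_le_cancel_iff) auto
  then show ?thesis using n(1) by (simp add: ln_powr s_def E_def)
qed

text \<open>The product over \<open>P\<close> is at most \<open>exp E \<le> 1 + 2 E\<close>, and raising the exponent by \<open>4 E / b\<close> lowers
\<open>\<zeta>\<close> to at most \<open>2 - 4 E\<close>; the product of these two numbers is at most \<open>2\<close>. Here \<open>b\<close> is the constant of
\<open>zeta_right_upper\<close>.\<close>

lemma ln_kalmar_le_of_prime_divisors:
  fixes P n
  defines "b \<equiv> 2 powr -kalmar_rho / 2" and "E \<equiv> (\<Sum>p\<in>P. real p powr -kalmar_rho)"
  assumes n: "n \<ge> 1" "finite P" "\<And>p. p \<in> P \<Longrightarrow> prime p \<and> p dvd n"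
    and E: "E \<le> b / 4"
  shows "ln (real (kalmar n)) \<le> (kalmar_rho + 4 * E / b) * ln (real n) - real (card P) * ln 2"
proof -
  define s where "s = kalmar_rho + 4 * E / b"
  have b: "b > 0" by (simp add: b_def)
  have "2 powr -kalmar_rho \<le> 2 powr (0::real)" using kalmar_rho by (intro powr_mono) auto
  then have "b \<le> 1 / 2" by (simp add: b_def)
  have E0: "E \<ge> 0" by (auto simp: E_def intro!: sum_nonneg)
  have d: "0 \<le> 4 * E / b" "4 * E / b \<le> 1" using E0 E b by (auto simp: field_simps)
  have "real (kalmar n) \<le> real n powr s / 2 ^ card P"
  proof (rule kalmar_le_of_prime_divisors[OF n])
    show "s > 1" using d kalmar_rho by (simp add: s_def)
    have "(\<Prod>p\<in>P. 1 + real p powr -s) \<le> (\<Prod>p\<in>P. exp (real p powr -kalmar_rho))"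
    proof (intro prod_mono conjI)
      fix p assume p: "p \<in> P"
      have "real p powr -s \<le> real p powr -kalmar_rho"
        using p d n(3)[OF p] prime_ge_1_nat[of p] by (intro powr_mono) (auto simp: s_def)
      then show "1 + real p powr -s \<le> exp (real p powr -kalmar_rho)"
        using exp_ge_add_one_self[of "real p powr -kalmar_rho"] by linarith
    qed (auto intro!: add_nonneg_nonneg)
    also have "\<dots> = exp E" using n(2) by (simp add: exp_sum E_def)
    also have "\<dots> \<le> 1 + E + E\<^sup>2" using E0 E \<open>b \<le> 1/2\<close> by (intro exp_bound) auto
    also have "\<dots> \<le> 1 + 2 * E"
      using mult_left_mono[of E 1 E] E0 E \<open>b \<le> 1/2\<close> by (simp add: power2_eq_square)
    finally have prod: "(\<Prod>p\<in>P. 1 + real p powr -s) \<le> 1 + 2 * E" .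
    have "zeta s \<le> 2 - 4 * E" using zeta_right_upper[OF d] b by (simp add: s_def b_def)
    then have "zeta s * (\<Prod>p\<in>P. 1 + real p powr -s) \<le> (2 - 4 * E) * (1 + 2 * E)"
      using prod E0 E \<open>b \<le> 1/2\<close> by (intro mult_mono) (auto intro!: prod_nonneg add_nonneg_nonneg)
    also have "\<dots> \<le> 2" using E0 by (simp add: algebra_simps)
    finally show "zeta s * (\<Prod>p\<in>P. 1 + real p powr -s) \<le> 2" .
  qed
  then have "ln (real (kalmar n)) \<le> ln (real n powr s / 2 ^ card P)"
    using n(1) kalmar_pos[of n] by (subst ln_le_cancel_iff) auto
  then show ?thesis using n(1) by (simp add: ln_div ln_powr ln_realpow s_def)
qed

text \<open>The dichotomy: among the primes in \<open>(a y, B a y]\<close>, either those not dividing \<open>n\<close> or those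
dividing \<open>n\<close> make up at least half.\<close>

lemma kalmar_upper:
  "\<exists>C>0. \<forall>\<^sub>F y in at_top. \<forall>n\<ge>1. ln (real n) = y powr kalmar_rho \<longrightarrow>
    ln (real (kalmar n)) \<le> kalmar_rho * ln (real n) - C * (y / ln y)"
proof -
  define r where "r = kalmar_rho"
  have r: "r > 1" using kalmar_rho by (simp add: r_def)
  obtain B1 d1 where B1: "B1 > 0" "d1 > 0" "d1 < r - 1"
      "\<And>d. 0 \<le> d \<Longrightarrow> d \<le> d1 \<Longrightarrow> zeta (r - d) \<le> 2 + B1 * d"
    using zeta_left_upper unfolding r_def by metis
  define b where "b = 2 powr -r / 2"
  have b: "b > 0" by (simp add: b_def)
  \<comment> \<open>Large enough for the increase \<open>4 E / b\<close> of the exponent, in the case of many prime divisors,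
    to cost at most half of the gain \<open>ln 2\<close> per prime.\<close>
  define a where "a = (8 / (b * ln 2)) powr (1 / r)"
  have a: "a > 0" "a powr r = 8 / (b * ln 2)" using b r by (auto simp: a_def powr_powr)
  obtain B where B: "B > 1" and primes: "\<forall>\<^sub>F z in at_top.
      z / (2 * ln z) \<le> real (card {p::nat. prime p \<and> z < real p \<and> real p \<le> B * z})"
    using many_primes_in_interval by auto
  define c where "c = min ((B * a) powr -r / B1) (ln 2 / 2)"
  have c: "c > 0" using B a B1 by (simp add: c_def)
  have az: "filterlim (\<lambda>y. a * y) at_top at_top"
    using a by (intro filterlim_tendsto_pos_mult_at_top[OF tendsto_const]) (auto simp: filterlim_ident)
  have "((\<lambda>y. B * (a * y) powr (1 - r)) \<longlongrightarrow> B * 0) at_top"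
    using r by (intro tendsto_intros tendsto_neg_powr az) auto
  then have "\<forall>\<^sub>F y in at_top. B * (a * y) powr (1 - r) < min (b / 4) (B1 * d1)"
    using b B1 by (intro order_tendstoD(2)) auto
  moreover have "\<forall>\<^sub>F y in at_top. a * y / (2 * ln (a * y))
      \<le> real (card {p::nat. prime p \<and> a * y < real p \<and> real p \<le> B * (a * y)})"
    using eventually_compose_filterlim[OF primes az] by simp
  moreover have "\<forall>\<^sub>F y in at_top. y \<ge> max 2 (max a (2 / a))" by (rule eventually_ge_at_top)
  ultimately have "\<forall>\<^sub>F y in at_top. \<forall>n\<ge>1. ln (real n) = y powr r \<longrightarrow>
      ln (real (kalmar n)) \<le> r * ln (real n) - c * a / 8 * (y / ln y)"
  proof eventually_elim
    case (elim y)
    then have y: "y \<ge> 2" "y \<ge> a" "a * y \<ge> 2" using a by (auto simp: field_simps)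
    define Q where "Q = {p::nat. prime p \<and> a * y < real p \<and> real p \<le> B * (a * y)}"
    have fin: "finite Q"
      by (rule finite_subset[of _ "{..nat \<lfloor>B * (a * y)\<rfloor>}"]) (auto simp: Q_def le_nat_floor)
    have "a * y / (2 * ln (a * y)) \<ge> a * y / (2 * (2 * ln y))"
    proof (intro divide_left_mono mult_left_mono)
      have "ln (a * y) \<le> ln (y * y)" using y a by (subst ln_le_cancel_iff) auto
      then show "ln (a * y) \<le> 2 * ln y" using y by (simp add: ln_mult)
    qed (use y a in auto)
    with elim(2) have cardQ: "real (card Q) \<ge> a / 4 * (y / ln y)" by (simp add: Q_def)
    have cardQ': "real (card Q) \<le> B * (a * y)"
    proof -
      have "Q \<subseteq> {1..nat \<lfloor>B * (a * y)\<rfloor>}" by (auto simp: Q_def le_nat_floor dest: prime_ge_1_nat)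
      from card_mono[OF _ this] have "real (card Q) \<le> real (nat \<lfloor>B * (a * y)\<rfloor>)" by simp
      also have "\<dots> \<le> B * (a * y)" using B y by (intro of_nat_floor) auto
      finally show ?thesis .
    qed
    define E where "E P = (\<Sum>p\<in>P. real p powr -r)" for P :: "nat set"
    have E: "real (card P) * (B * (a * y)) powr -r \<le> E P" "E P \<le> real (card P) * (a * y) powr -r"
        "E P \<le> b / 4" "E P \<le> B1 * d1" if "P \<subseteq> Q" for P
    proof -
      show "real (card P) * (B * (a * y)) powr -r \<le> E P"
        unfolding E_def using that r y by (intro sum_bounded_below powr_mono2') (auto simp: Q_def)
      show le: "E P \<le> real (card P) * (a * y) powr -r"
        unfolding E_def using that r y by (intro sum_bounded_above powr_mono2') (auto simp: Q_def)
      have "real (card P) \<le> B * (a * y)" using card_mono[OF fin that] cardQ' by linarith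
      then have "real (card P) * (a * y) powr -r \<le> B * (a * y) * (a * y) powr -r"
        by (intro mult_right_mono) auto
      also have "\<dots> = B * (a * y) powr (1 - r)" using y by (simp add: powr_diff powr_minus_divide)
      finally show "E P \<le> b / 4" "E P \<le> B1 * d1" using le elim(1) by auto
    qed
    show ?case
    proof (intro allI impI)
      fix n :: nat assume n: "1 \<le> n" "ln (real n) = y powr r"
      define P where "P = {p\<in>Q. p dvd n}"
      define P' where "P' = {p\<in>Q. \<not> p dvd n}"
      have PQ: "P \<subseteq> Q" "P' \<subseteq> Q" and fP: "finite P" "finite P'"
        using fin by (auto simp: P_def P'_def)
      have "Q = P \<union> P'" "P \<inter> P' = {}" by (auto simp: P_def P'_def)
      then have card: "card Q = card P + card P'" using fP by (simp add: card_Un_disjoint)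
      have ypow: "y powr r * y powr -r = 1" using y by (simp add: powr_add[symmetric])
      have "\<exists>S :: nat set. real (card Q) \<le> 2 * real (card S) \<and> ln (real (kalmar n)) \<le> r * ln (real n) - c * real (card S)"
      proof (cases "card P \<le> card P'")
        case True
        have "ln (real (kalmar n)) \<le> (r - E P' / B1) * ln (real n)"
          unfolding r_def E_def
          using B1 n fP E(4)[OF PQ(2)]
          by (intro ln_kalmar_le_of_coprime_primes[where dmax = d1]) (auto simp: r_def E_def P'_def Q_def)
        moreover have "c * real (card P') \<le> E P' / B1 * ln (real n)"
        proof -
          have "c * real (card P') \<le> (B * a) powr -r / B1 * real (card P')"
            by (intro mult_right_mono) (auto simp: c_def)
          also have "\<dots> = (B * a) powr -r / B1 * real (card P') * (y powr r * y powr -r)"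
            using ypow by simp
          also have "\<dots> = real (card P') * (B * (a * y)) powr -r / B1 * y powr r"
            using B a y by (simp add: powr_mult mult_ac)
          also have "\<dots> \<le> E P' / B1 * y powr r"
            using E(1)[OF PQ(2)] B1 by (intro mult_right_mono divide_right_mono) auto
          finally show ?thesis using n by simp
        qed
        ultimately have "ln (real (kalmar n)) \<le> r * ln (real n) - c * real (card P')"
          unfolding left_diff_distrib by linarith
        then show ?thesis using True card by (intro exI[of _ P'] conjI) auto
      next
        case False
        have "ln (real (kalmar n)) \<le> (r + 4 * E P / b) * ln (real n) - real (card P) * ln 2"
          unfolding r_def E_def b_def
          using n fP E(3)[OF PQ(1)]
          by (intro ln_kalmar_le_of_prime_divisors) (auto simp: r_def E_def P_def Q_def b_def)
        moreover have "4 * E P / b * ln (real n) \<le> real (card P) * ln 2 / 2"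
        proof -
          have "4 * E P / b * y powr r \<le> 4 * (real (card P) * (a * y) powr -r) / b * y powr r"
            using E(2)[OF PQ(1)] b by (intro mult_right_mono divide_right_mono) auto
          also have "\<dots> = 4 * real (card P) * a powr -r / b * (y powr r * y powr -r)"
            using a y by (simp add: powr_mult mult_ac)
          also have "\<dots> = real (card P) * (ln 2 / 2)"
            unfolding ypow powr_minus_divide a(2) using b y by (simp add: field_simps)
          finally show ?thesis using n by simp
        qed
        moreover have "c * real (card P) \<le> real (card P) * ln 2 / 2"
          using mult_right_mono[of c "ln 2 / 2" "real (card P)"] by (simp add: c_def mult.commute)
        ultimately have "ln (real (kalmar n)) \<le> r * ln (real n) - c * real (card P)"
          unfolding distrib_right[of r] by linarith
        then show ?thesis using False card by (intro exI[of _ P] conjI) auto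
      qed
      then obtain S :: "nat set" where S: "real (card Q) \<le> 2 * real (card S)"
          "ln (real (kalmar n)) \<le> r * ln (real n) - c * real (card S)" by blast
      have "c * (a / 8 * (y / ln y)) \<le> c * real (card S)"
        using S(1) cardQ c by (intro mult_left_mono) auto
      with S(2) show "ln (real (kalmar n)) \<le> r * ln (real n) - c * a / 8 * (y / ln y)" by simp
    qed
  qed
  moreover have "c * a / 8 > 0" using c a by simp
  ultimately show ?thesis unfolding r_def by blast
qed

section \<open>Completely multiplicative damping weights\<close>

definition sieve_weight :: "(nat \<Rightarrow> real) \<Rightarrow> nat \<Rightarrow> real" where
  "sieve_weight e x = (\<Prod>p\<in>#prime_factorization x. 1 - e p)"

lemma sieve_weight_1: "sieve_weight e 1 = 1"
  by (simp add: sieve_weight_def)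

lemma sieve_weight_mult:
  assumes "x \<ge> 1" "y \<ge> 1"
  shows "sieve_weight e (x * y) = sieve_weight e x * sieve_weight e y"
  using assms by (simp add: sieve_weight_def prime_factorization_mult)

lemma sieve_weight_prime: "prime q \<Longrightarrow> sieve_weight e q = 1 - e q"
  by (simp add: sieve_weight_def prime_factorization_prime)

text \<open>The last part is the Weierstrass product inequality; the bounds on the product are needed for its
induction step.\<close>

lemma prod_mset_one_minus_bounds:
  fixes e :: "'a \<Rightarrow> real"
  assumes "\<And>p. 0 \<le> e p" "\<And>p. e p \<le> 1"
  shows "0 \<le> (\<Prod>p\<in>#M. 1 - e p) \<and> (\<Prod>p\<in>#M. 1 - e p) \<le> 1
    \<and> 1 - (\<Prod>p\<in>#M. 1 - e p) \<le> (\<Sum>p\<in>#M. e p)"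
proof (induction M)
  case (add q M)
  define u where "u = (\<Prod>p\<in>#M. 1 - e p)"
  have u: "0 \<le> u" "u \<le> 1" "1 - u \<le> (\<Sum>p\<in>#M. e p)" using add by (auto simp: u_def)
  have "0 \<le> (1 - e q) * u" "(1 - e q) * u \<le> 1"
    using u assms[of q] by (auto intro!: mult_le_one)
  moreover have "e q * u \<le> e q" using u assms[of q] by (simp add: mult_left_le)
  ultimately show ?case using u by (simp add: u_def[symmetric] algebra_simps)
qed auto

lemma sieve_weight_nonneg:
  assumes "\<And>p. 0 \<le> e p" "\<And>p. e p \<le> 1"
  shows "sieve_weight e x \<ge> 0"
  using prod_mset_one_minus_bounds[where e = e and M = "prime_factorization x"] assms by (simp add: sieve_weight_def)

lemma sum_mset_eq_sum_count:
  fixes f :: "'a \<Rightarrow> real"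
  assumes "finite S" "set_mset M \<subseteq> S"
  shows "(\<Sum>p\<in>#M. f p) = (\<Sum>p\<in>S. real (count M p) * f p)"
  using assms(2)
proof (induction M)
  case (add q M)
  have "(\<Sum>p\<in>S. real (count (add_mset q M) p) * f p)
      = (\<Sum>p\<in>S. real (count M p) * f p + (if p = q then f p else 0))"
    by (intro sum.cong refl) (simp add: algebra_simps)
  then show ?case using add assms(1) by (simp add: sum.distrib)
qed auto

lemma one_minus_sieve_weight_le:
  assumes "\<And>p. 0 \<le> e p" "\<And>p. e p \<le> 1" "1 \<le> x" "x \<le> n"
  shows "1 - sieve_weight e x \<le> (\<Sum>p | prime p \<and> p \<le> n. real (multiplicity p x) * e p)"
proof -
  have "1 - sieve_weight e x \<le> (\<Sum>p\<in>#prime_factorization x. e p)"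
    using prod_mset_one_minus_bounds[where e = e and M = "prime_factorization x"] assms by (simp add: sieve_weight_def)
  also have "\<dots> = (\<Sum>p | prime p \<and> p \<le> n. real (count (prime_factorization x) p) * e p)"
  proof (rule sum_mset_eq_sum_count)
    show "prime_factors x \<subseteq> {p. prime p \<and> p \<le> n}"
    proof
      fix p assume "p \<in> prime_factors x"
      then have "prime p" "p dvd x" by auto
      then show "p \<in> {p. prime p \<and> p \<le> n}" using dvd_imp_le[of p x] assms by auto
    qed
  qed auto
  also have "\<dots> = (\<Sum>p | prime p \<and> p \<le> n. real (multiplicity p x) * e p)"
    by (intro sum.cong refl) (simp add: count_prime_factorization_prime)
  finally show ?thesis .
qed

text \<open>The sum \<open>F\<close> satisfies \<open>F \<le> p\<^bsup>-s\<^esup> (\<zeta>(s) + F)\<close> with \<open>p\<^bsup>-s\<^esup> \<le> 1/2\<close>.\<close>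

lemma sum_powr_multiplicity_le:
  assumes "prime p" "s > 1"
  shows "(\<Sum>x=1..X. real x powr -s * real (multiplicity p x)) \<le> 2 * zeta s * real p powr -s"
proof -
  define F where "F X = (\<Sum>x=1..X. real x powr -s * real (multiplicity p x))" for X
  define c where "c = real p powr -s"
  have "c \<le> 2 powr -1"
  proof -
    have "c \<le> 2 powr -s" unfolding c_def using assms prime_ge_2_nat[of p] by (intro powr_mono2') auto
    also have "\<dots> \<le> 2 powr -1" using assms by (intro powr_mono) auto
    finally show ?thesis .
  qed
  then have c: "0 \<le> c" "c \<le> 1/2" by (auto simp: c_def powr_minus_divide)
  have F0: "F X \<ge> 0" unfolding F_def by (intro sum_nonneg) auto
  have "F X = (\<Sum>x=1..X div p. real (p * x) powr -s * (1 + real (multiplicity p x)))"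
    unfolding F_def by (rule sum_multiplicity[OF assms(1)])
  also have "\<dots> = c * ((\<Sum>x=1..X div p. real x powr -s) + F (X div p))"
    by (simp add: c_def F_def powr_mult sum_distrib_left sum.distrib algebra_simps)
  also have "\<dots> \<le> c * (zeta s + F X)"
  proof (intro mult_left_mono add_mono c)
    show "(\<Sum>x=1..X div p. real x powr -s) \<le> zeta s" using assms by (intro sum_le_zeta) auto
    show "F (X div p) \<le> F X"
      unfolding F_def by (intro sum_mono2) (auto intro: order_trans[OF _ div_le_dividend])
  qed
  also have "\<dots> \<le> c * zeta s + F X / 2"
    using mult_right_mono[OF c(2) F0] by (simp add: distrib_left)
  finally have "F X / 2 \<le> c * zeta s" by simp
  then show ?thesis by (simp add: F_def c_def mult_ac)
qed

text \<open>The loss caused by the weights is controlled by a union bound over the primes: \<open>1 - u(x)\<close> is at most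
the sum of \<open>e\<^sub>p\<close> over the prime factors of \<open>x\<close> with multiplicity.\<close>

lemma sum_sieve_weight_powr_ge:
  assumes "\<And>p. 0 \<le> e p" "\<And>p. e p \<le> 1" "s > 1"
  shows "(\<Sum>x=1..X. sieve_weight e x * real x powr -s)
    \<ge> (\<Sum>x=1..X. real x powr -s) - 2 * zeta s * (\<Sum>p | prime p \<and> p \<le> X. e p * real p powr -s)"
proof -
  let ?P = "{p. prime p \<and> p \<le> X}"
  have "(\<Sum>x=1..X. real x powr -s) - (\<Sum>x=1..X. sieve_weight e x * real x powr -s)
      = (\<Sum>x=1..X. real x powr -s * (1 - sieve_weight e x))"
    by (simp add: sum_subtractf algebra_simps)
  also have "\<dots> \<le> (\<Sum>x=1..X. real x powr -s * (\<Sum>p\<in>?P. real (multiplicity p x) * e p))"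
    using assms by (intro sum_mono mult_left_mono one_minus_sieve_weight_le) auto
  also have "\<dots> = (\<Sum>x=1..X. \<Sum>p\<in>?P. e p * (real x powr -s * real (multiplicity p x)))"
    by (simp add: sum_distrib_left mult_ac)
  also have "\<dots> = (\<Sum>p\<in>?P. e p * (\<Sum>x=1..X. real x powr -s * real (multiplicity p x)))"
    unfolding sum_distrib_left by (rule sum.swap)
  also have "\<dots> \<le> (\<Sum>p\<in>?P. e p * (2 * zeta s * real p powr -s))"
    using assms by (intro sum_mono mult_left_mono sum_powr_multiplicity_le) auto
  also have "\<dots> = 2 * zeta s * (\<Sum>p\<in>?P. e p * real p powr -s)"
    by (simp add: sum_distrib_left mult_ac)
  finally show ?thesis by linarith
qed

text \<open>The Euler product of the weights, \<open>1 / e\<^sub>p\<close> being the sum of the geometric series with ratio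
\<open>1 - e\<^sub>p\<close>. On adding a prime \<open>q\<close>, splitting off its multiples bounds the new sum \<open>S\<close> by the old bound
plus \<open>(1 - e\<^sub>q) S\<close>.\<close>

lemma sum_sieve_weight_smooth_le:
  assumes "finite P" "\<And>p. p \<in> P \<Longrightarrow> prime p \<and> 0 < e p" "\<And>p. 0 \<le> e p" "\<And>p. e p \<le> 1"
  shows "(\<Sum>x=1..X. if prime_factors x \<subseteq> P then sieve_weight e x else 0) \<le> (\<Prod>p\<in>P. 1 / e p)"
  using assms(1,2)
proof (induction P rule: finite_induct)
  case empty
  have "(\<Sum>x=1..X. if prime_factors x \<subseteq> {} then sieve_weight e x else 0) \<le> (\<Sum>x=1..X. if x = 1 then 1 else 0)"
  proof (intro sum_mono)
    fix x assume x: "x \<in> {1..X}"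
    show "(if prime_factors x \<subseteq> {} then sieve_weight e x else 0) \<le> (if x = 1 then 1 else 0)"
    proof (cases "prime_factors x \<subseteq> {}")
      case True
      with x have "x = 1" by (simp add: prime_factorization_empty_iff)
      then show ?thesis by (simp add: sieve_weight_def)
    qed simp
  qed
  also have "\<dots> \<le> 1" by simp
  finally show ?case by simp
next
  case (insert q P)
  have q: "prime q" "0 < e q" using insert.prems by auto
  define g where "g x = (if prime_factors x \<subseteq> insert q P then sieve_weight e x else 0)" for x
  have g0: "g x \<ge> 0" for x using sieve_weight_nonneg[of e x] assms by (simp add: g_def)
  have gq: "g (q * x) = (1 - e q) * g x" if "x \<ge> 1" for x
  proof -
    have "prime_factors (q * x) = insert q (prime_factors x)"
      using that q by (simp add: prime_factorization_mult prime_factorization_prime)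
    then show ?thesis
      using that q prime_ge_1_nat[of q] by (simp add: g_def sieve_weight_mult sieve_weight_prime)
  qed
  have "(\<Sum>x=1..X. g x) = (\<Sum>x\<in>{x\<in>{1..X}. \<not> q dvd x}. g x) + (\<Sum>x\<in>{x\<in>{1..X}. q dvd x}. g x)"
    by (subst sum.union_disjoint[symmetric]) (auto intro!: sum.cong)
  also have "(\<Sum>x\<in>{x\<in>{1..X}. \<not> q dvd x}. g x)
      \<le> (\<Sum>x\<in>{x\<in>{1..X}. \<not> q dvd x}. if prime_factors x \<subseteq> P then sieve_weight e x else 0)"
    by (intro sum_mono) (auto simp: g_def)
  also have "\<dots> \<le> (\<Sum>x=1..X. if prime_factors x \<subseteq> P then sieve_weight e x else 0)"
    using sieve_weight_nonneg[of e] assms by (intro sum_mono2) auto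
  also have "\<dots> \<le> (\<Prod>p\<in>P. 1 / e p)" using insert by auto
  also have "(\<Sum>x\<in>{x\<in>{1..X}. q dvd x}. g x) = (\<Sum>x=1..X div q. g (q * x))"
    using q by (intro sum_multiples) (simp add: prime_gt_0_nat)
  also have "\<dots> = (1 - e q) * (\<Sum>x=1..X div q. g x)"
    unfolding sum_distrib_left by (intro sum.cong refl gq) auto
  also have "\<dots> \<le> (1 - e q) * (\<Sum>x=1..X. g x)"
    using assms(4)[of q] g0
    by (intro mult_left_mono sum_mono2) (auto intro: order_trans[OF _ div_le_dividend])
  finally have "e q * (\<Sum>x=1..X. g x) \<le> (\<Prod>p\<in>P. 1 / e p)" by (simp add: algebra_simps)
  then show ?case
    using insert.hyps q by (simp add: g_def field_simps)
qed

lemma sum_sieve_weight_le: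
  assumes "finite P" "\<And>p. p \<in> P \<Longrightarrow> prime p \<and> 0 < e p" "\<And>p. 0 \<le> e p" "\<And>p. e p \<le> 1"
    and "\<And>p. prime p \<Longrightarrow> p \<notin> P \<Longrightarrow> e p = 1"
  shows "(\<Sum>x=1..X. sieve_weight e x) \<le> (\<Prod>p\<in>P. 1 / e p)"
proof -
  have "(\<Sum>x=1..X. sieve_weight e x) = (\<Sum>x=1..X. if prime_factors x \<subseteq> P then sieve_weight e x else 0)"
  proof (intro sum.cong refl)
    fix x :: nat
    have "sieve_weight e x = 0" if "\<not> prime_factors x \<subseteq> P"
    proof -
      from that obtain p where p: "p \<in> prime_factors x" "p \<notin> P" by auto
      then have "1 - e p = 0" using assms(5)[of p] by auto
      then have "0 \<in># image_mset (\<lambda>p. 1 - e p) (prime_factorization x)" using p by force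
      then show ?thesis unfolding sieve_weight_def by (simp add: prod_mset_zero_iff)
    qed
    then show "sieve_weight e x = (if prime_factors x \<subseteq> P then sieve_weight e x else 0)" by auto
  qed
  also have "\<dots> \<le> (\<Prod>p\<in>P. 1 / e p)" using assms by (intro sum_sieve_weight_smooth_le) auto
  finally show ?thesis .
qed

section \<open>Lower bound\<close>

text \<open>Each \<open>m \<ge> 2\<close> is split as \<open>x m'\<close> according to the recursion, and the sum is reordered by the first factor
\<open>x\<close>.\<close>

lemma sum_kalmar_rec:
  fixes u :: "nat \<Rightarrow> real"
  assumes "u 1 = 1" "\<And>x y. x \<ge> 1 \<Longrightarrow> y \<ge> 1 \<Longrightarrow> u (x * y) = u x * u y" "k \<ge> 1"
  shows "(\<Sum>m=1..k. real (kalmar m) * u m)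
    = 1 + (\<Sum>x=2..k. u x * (\<Sum>m=1..k div x. real (kalmar m) * u m))"
proof -
  have "(\<Sum>x=2..k. u x * (\<Sum>m=1..k div x. real (kalmar m) * u m))
      = (\<Sum>x=2..k. \<Sum>m\<in>{m\<in>{1..k}. x dvd m}. u m * real (kalmar (m div x)))"
  proof (intro sum.cong refl)
    fix x assume x: "x \<in> {2..k}"
    have "(\<Sum>m\<in>{m\<in>{1..k}. x dvd m}. u m * real (kalmar (m div x)))
        = (\<Sum>m=1..k div x. u (x * m) * real (kalmar (x * m div x)))"
      using x by (intro sum_multiples) auto
    also have "\<dots> = (\<Sum>m=1..k div x. u x * (real (kalmar m) * u m))"
      using x assms(2) by (intro sum.cong refl) auto
    finally show "u x * (\<Sum>m=1..k div x. real (kalmar m) * u m)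
        = (\<Sum>m\<in>{m\<in>{1..k}. x dvd m}. u m * real (kalmar (m div x)))"
      by (simp add: sum_distrib_left)
  qed
  also have "\<dots> = (\<Sum>m=1..k. \<Sum>x\<in>{x\<in>{2..k}. x dvd m}. u m * real (kalmar (m div x)))"
    by (rule sum.swap_restrict) auto
  also have "\<dots> = (\<Sum>m=2..k. \<Sum>x\<in>{x\<in>{2..k}. x dvd m}. u m * real (kalmar (m div x)))"
  proof (intro sum.mono_neutral_right ballI)
    fix m assume "m \<in> {1..k} - {2..k}"
    then have "{x\<in>{2..k}. x dvd m} = {}" by (auto dest!: dvd_imp_le)
    then show "(\<Sum>x\<in>{x\<in>{2..k}. x dvd m}. u m * real (kalmar (m div x))) = 0" by (simp only: sum.empty)
  qed auto
  also have "\<dots> = (\<Sum>m=2..k. real (kalmar m) * u m)"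
  proof (intro sum.cong refl)
    fix m assume m: "m \<in> {2..k}"
    have "{x\<in>{2..k}. x dvd m} = {x. x dvd m \<and> 2 \<le> x}"
      using m by (auto dest: dvd_imp_le)
    then show "(\<Sum>x\<in>{x\<in>{2..k}. x dvd m}. u m * real (kalmar (m div x))) = real (kalmar m) * u m"
      using m by (simp add: kalmar_rec[of m] sum_distrib_left mult.commute)
  qed
  finally have "(\<Sum>x=2..k. u x * (\<Sum>m=1..k div x. real (kalmar m) * u m)) = (\<Sum>m=2..k. real (kalmar m) * u m)" .
  moreover have "(\<Sum>m=1..k. real (kalmar m) * u m) = real (kalmar 1) * u 1 + (\<Sum>m=Suc 1..k. real (kalmar m) * u m)"
    using assms(3) by (intro sum.atLeast_Suc_atMost)
  ultimately show ?thesis using assms(1) by (simp add: kalmar_def numeral_2_eq_2)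
qed

text \<open>The claim carried by the induction is \<open>\<Sum>u(m) K(m) \<ge> (k + 1)\<^bsup>s\<^esup> / N\<close> over \<open>m \<le> k\<close>. With \<open>k + 1\<close>
instead of \<open>k\<close> it is stable under integer division, as \<open>(k div x) + 1 \<ge> (k + 1) / x\<close>. The factors
\<open>x > k\<close>, which the recursion does not see, contribute at most \<open>N (k + 1)\<^bsup>-s\<^esup>\<close> to \<open>\<Sum>u(x) x\<^bsup>-s\<^esup>\<close>, and
this deficit is made up exactly by the initial term \<open>1\<close>.\<close>

lemma kalmar_large_value:
  fixes u :: "nat \<Rightarrow> real"
  assumes u: "\<And>x. u x \<ge> 0" "u 1 = 1" "\<And>x y. x \<ge> 1 \<Longrightarrow> y \<ge> 1 \<Longrightarrow> u (x * y) = u x * u y"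
    and N: "\<And>X. (\<Sum>x=1..X. u x) \<le> N"
    and s: "s > 0" "\<forall>\<^sub>F X in sequentially. (\<Sum>x=1..X. u x * real x powr -s) \<ge> 2"
    and n: "n \<ge> 1"
  shows "\<exists>m\<in>{1..n}. real (kalmar m) \<ge> real n powr s / N\<^sup>2"
proof -
  have N1: "N \<ge> 1" using N[of 1] u(2) by simp
  define A where "A k = (\<Sum>m=1..k. real (kalmar m) * u m)" for k
  have partial: "(\<Sum>x=1..k. u x * real x powr -s) \<ge> 2 - N * real (Suc k) powr -s" for k
  proof -
    obtain X where X: "X \<ge> k" "(\<Sum>x=1..X. u x * real x powr -s) \<ge> 2"
      using s(2) unfolding eventually_sequentially by (metis nat_le_linear)
    have "{1..X} = {1..k} \<union> {Suc k..X}" using X(1) by auto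
    then have "(\<Sum>x=1..X. u x * real x powr -s)
        = (\<Sum>x=1..k. u x * real x powr -s) + (\<Sum>x=Suc k..X. u x * real x powr -s)"
      by (simp only:) (rule sum.union_disjoint, auto)
    also have "(\<Sum>x=Suc k..X. u x * real x powr -s) \<le> (\<Sum>x=Suc k..X. u x * real (Suc k) powr -s)"
      using u s(1) by (intro sum_mono mult_left_mono powr_mono2') auto
    also have "\<dots> = (\<Sum>x=Suc k..X. u x) * real (Suc k) powr -s" by (simp only: sum_distrib_right)
    also have "\<dots> \<le> (\<Sum>x=1..X. u x) * real (Suc k) powr -s"
      using u by (intro mult_right_mono sum_mono2) auto
    also have "\<dots> \<le> N * real (Suc k) powr -s" by (intro mult_right_mono N) auto
    finally show ?thesis using X(2) by linarith
  qed
  have A: "A k \<ge> real (Suc k) powr s / N" if "k \<ge> 1" for k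
    using that
  proof (induction k rule: less_induct)
    case (less k)
    have "real (Suc k) powr s / N * (1 - N * real (Suc k) powr -s)
        \<le> real (Suc k) powr s / N * (\<Sum>x=2..k. u x * real x powr -s)"
    proof (intro mult_left_mono)
      have "(\<Sum>x=1..k. u x * real x powr -s) = u 1 * real 1 powr -s + (\<Sum>x=Suc 1..k. u x * real x powr -s)"
        using less.prems by (intro sum.atLeast_Suc_atMost)
      then show "1 - N * real (Suc k) powr -s \<le> (\<Sum>x=2..k. u x * real x powr -s)"
        using partial[of k] u(2) by (simp add: numeral_2_eq_2)
    qed (use N1 in auto)
    also have "\<dots> = (\<Sum>x=2..k. u x * ((real (Suc k) / real x) powr s / N))"
      by (simp add: sum_distrib_left sum_divide_distrib powr_divide powr_minus_divide field_simps)
    also have "\<dots> \<le> (\<Sum>x=2..k. u x * A (k div x))"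
    proof (intro sum_mono mult_left_mono u(1))
      fix x assume x: "x \<in> {2..k}"
      have "Suc k \<le> Suc (k div x) * x"
        using x dividend_less_div_times[of x k] by (simp add: mult.commute)
      then have "real (Suc k) \<le> real (Suc (k div x)) * real x"
        by (metis of_nat_le_iff of_nat_mult)
      then have "(real (Suc k) / real x) powr s \<le> real (Suc (k div x)) powr s"
        using x s(1) by (intro powr_mono2) (auto simp: pos_divide_le_eq)
      then have "(real (Suc k) / real x) powr s / N \<le> real (Suc (k div x)) powr s / N"
        using N1 by (intro divide_right_mono) auto
      also have "\<dots> \<le> A (k div x)"
        using x less.prems by (intro less.IH) (auto simp: div_greater_zero_iff Suc_le_eq)
      finally show "(real (Suc k) / real x) powr s / N \<le> A (k div x)" .
    qed
    also have "\<dots> = A k - 1"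
      using sum_kalmar_rec[of u k] u less.prems by (simp add: A_def)
    finally have "real (Suc k) powr s / N * (1 - N * real (Suc k) powr -s) \<le> A k - 1" .
    moreover have "real (Suc k) powr s / N * (1 - N * real (Suc k) powr -s) = real (Suc k) powr s / N - 1"
      using N1 by (simp add: right_diff_distrib powr_minus_divide)
    ultimately show ?case by linarith
  qed
  show ?thesis
  proof (rule ccontr)
    assume "\<not> ?thesis"
    then have "real (kalmar m) < real n powr s / N\<^sup>2" if "m \<in> {1..n}" for m
      using that by (meson not_le)
    then have "A n \<le> (\<Sum>m=1..n. real n powr s / N\<^sup>2 * u m)"
      unfolding A_def using u(1) by (intro sum_mono mult_right_mono) (auto intro: less_imp_le)
    also have "\<dots> = real n powr s / N\<^sup>2 * (\<Sum>m=1..n. u m)" by (simp only: sum_distrib_left)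
    also have "\<dots> \<le> real n powr s / N\<^sup>2 * N" using N1 by (intro mult_left_mono N) auto
    also have "\<dots> = real n powr s / N" using N1 by (simp add: power2_eq_square)
    also have "\<dots> < real (Suc n) powr s / N"
      using N1 s(1) n by (intro divide_strict_right_mono powr_less_mono2) auto
    finally show False using A[OF n] by linarith
  qed
qed

text \<open>Both follow from \<open>ln y \<le> 4 (t - 1)\<close> with \<open>t\<close> the fourth root of \<open>y\<close>, the first one since
\<open>4 (t - 1) \<le> t\<^sup>2\<close>.\<close>

lemma ln_le_sqrt:
  fixes y :: real
  assumes "y \<ge> 1"
  shows "ln y \<le> sqrt y" "(ln y)\<^sup>2 \<le> 16 * sqrt y"
proof -
  define t where "t = sqrt (sqrt y)"
  have t: "t \<ge> 1" "t * t = sqrt y" using assms by (auto simp: t_def)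
  have "ln y = 4 * ln t" using assms by (simp add: t_def ln_sqrt)
  then have 1: "ln y \<le> 4 * (t - 1)" using ln_le_minus_one[of t] t by simp
  have "(t - 2) * (t - 2) \<ge> 0" by simp
  then show "ln y \<le> sqrt y" using 1 t(2) by (simp add: algebra_simps)
  have "(ln y)\<^sup>2 \<le> (4 * t)\<^sup>2" using 1 t assms by (intro power_mono) auto
  then show "(ln y)\<^sup>2 \<le> 16 * sqrt y" using t(2) by (simp add: power2_eq_square algebra_simps)
qed

text \<open>By \<open>1 + x \<le> exp x\<close>, each term \<open>b\<^bsup>-s\<^esup>\<close> is at most the difference of \<open>b\<^bsup>1-s\<^esup> / (s - 1)\<close> between \<open>b - 1\<close>
and \<open>b\<close>, and these differences telescope.\<close>

lemma sum_powr_shift_le: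
  fixes y s :: real
  assumes "y > 0" "s > 1"
  shows "(\<Sum>m=1..X. (real m + y) powr -s) \<le> y powr (1 - s) / (s - 1)"
proof -
  have step: "b powr -s * (s - 1) \<le> (b - 1) powr (1 - s) - b powr (1 - s)" if "b > 1" for b :: real
  proof -
    have "1 + (s - 1) / b \<le> exp ((s - 1) / b)" by (rule exp_ge_add_one_self)
    also have "\<dots> \<le> exp ((1 - s) * ln (1 - 1 / b))"
    proof -
      have "ln (1 - 1 / b) \<le> - (1 / b)" using ln_le_minus_one[of "1 - 1 / b"] that by simp
      then have "(s - 1) * ln (1 - 1 / b) \<le> (s - 1) * - (1 / b)" using assms by (intro mult_left_mono) auto
      then show ?thesis by (simp add: algebra_simps)
    qed
    also have "\<dots> = ((b - 1) / b) powr (1 - s)"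
      using that by (simp add: powr_def diff_divide_distrib)
    finally have "b powr (1 - s) * (1 + (s - 1) / b) \<le> b powr (1 - s) * ((b - 1) / b) powr (1 - s)"
      by (intro mult_left_mono) auto
    also have "\<dots> = (b - 1) powr (1 - s)" using that by (simp add: powr_mult[symmetric])
    finally have "b powr (1 - s) + b powr (1 - s) / b * (s - 1) \<le> (b - 1) powr (1 - s)"
      by (simp add: algebra_simps)
    moreover have "b powr (1 - s) / b = b powr -s" using that by (simp add: powr_diff powr_minus_divide)
    ultimately show ?thesis by simp
  qed
  have "(\<Sum>m=1..X. (real m + y) powr -s) * (s - 1) \<le> y powr (1 - s) - (real X + y) powr (1 - s)"
  proof (induction X)
    case (Suc X)
    have "(real (Suc X) + y) powr -s * (s - 1)
        \<le> (real (Suc X) + y - 1) powr (1 - s) - (real (Suc X) + y) powr (1 - s)"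
      using assms by (intro step) auto
    then show ?case using Suc by (simp add: algebra_simps)
  qed auto
  also have "\<dots> \<le> y powr (1 - s)" by simp
  finally show ?thesis using assms by (simp add: pos_le_divide_eq)
qed

text \<open>The loss in \<open>\<zeta>(s)\<close> under the weights of the lower bound. The integers are summed after
replacing \<open>max m y\<close> by \<open>(m + y) / 2\<close>.\<close>

lemma sum_primes_max_powr_le:
  fixes y s :: real
  assumes "1 < s0" "s0 \<le> s" "s \<le> r" "y > 1"
  shows "(\<Sum>p | prime p \<and> p \<le> X. max (real p) y powr -s)
    \<le> (1 + 2 * ln 4 * 2 powr r / (s0 - 1)) * (y powr (1 - s) / ln y)"
proof -
  let ?h = "\<lambda>m. max (real m) y powr -s"
  have "(\<Sum>p | prime p \<and> p \<le> X. ?h p) \<le> sqrt y * ?h 1 + 2 * ln 4 / ln y * (\<Sum>m=1..X. ?h m)"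
    using assms by (intro sum_primes_antitone_le) (auto intro!: powr_mono2')
  also have "sqrt y * ?h 1 \<le> y powr (1 - s) / ln y"
  proof -
    have "sqrt y * ln y \<le> y" using mult_left_mono[OF ln_le_sqrt(1)[of y], of "sqrt y"] assms by simp
    then have "sqrt y \<le> y / ln y" using assms by (simp add: pos_le_divide_eq)
    then have "sqrt y * y powr -s \<le> y / ln y * y powr -s" by (intro mult_right_mono) auto
    also have "\<dots> = y powr (1 - s) / ln y" using assms by (simp add: powr_diff powr_minus_divide)
    finally show ?thesis using assms by (simp add: max_absorb2)
  qed
  also have "2 * ln 4 / ln y * (\<Sum>m=1..X. ?h m) \<le> 2 * ln 4 / ln y * (2 powr r * (y powr (1 - s) / (s0 - 1)))"
  proof (intro mult_left_mono)
    have "(\<Sum>m=1..X. ?h m) \<le> (\<Sum>m=1..X. 2 powr r * (real m + y) powr -s)"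
    proof (intro sum_mono)
      fix m :: nat
      have "?h m \<le> ((real m + y) / 2) powr -s"
        using assms by (intro powr_mono2') (auto simp: max_def)
      also have "\<dots> = 2 powr s * (real m + y) powr -s"
        using assms by (simp add: powr_divide powr_minus_divide)
      also have "\<dots> \<le> 2 powr r * (real m + y) powr -s"
        using assms by (intro mult_right_mono powr_mono) auto
      finally show "?h m \<le> 2 powr r * (real m + y) powr -s" .
    qed
    also have "\<dots> = 2 powr r * (\<Sum>m=1..X. (real m + y) powr -s)" by (simp add: sum_distrib_left)
    also have "(\<Sum>m=1..X. (real m + y) powr -s) \<le> y powr (1 - s) / (s - 1)"
      using assms by (intro sum_powr_shift_le) auto
    also have "y powr (1 - s) / (s - 1) \<le> y powr (1 - s) / (s0 - 1)"
      using assms by (intro divide_left_mono) auto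
    finally show "(\<Sum>m=1..X. ?h m) \<le> 2 powr r * (y powr (1 - s) / (s0 - 1))" by (simp add: mult_left_mono)
  qed (use assms in auto)
  finally have "(\<Sum>p | prime p \<and> p \<le> X. ?h p)
      \<le> y powr (1 - s) / ln y + 2 * ln 4 / ln y * (2 powr r * (y powr (1 - s) / (s0 - 1)))"
    by simp
  then show ?thesis by (simp add: algebra_simps)
qed

text \<open>The logarithm of the Euler product of the weights. Over all integers \<open>m \<le> k\<close> the sum is
\<open>ln (y\<^sup>k / k!) \<le> y\<close>.\<close>

lemma sum_primes_ln_ratio_le:
  fixes y :: real
  assumes "y > 1"
  shows "(\<Sum>p | prime p \<and> p \<le> nat \<lfloor>y\<rfloor>. ln (y / real p)) \<le> (16 + 2 * ln 4) * (y / ln y)"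
proof -
  define k where "k = nat \<lfloor>y\<rfloor>"
  define h where "h m = max 0 (ln (y / real m))" for m :: nat
  have k: "real k \<le> y" using assms by (simp add: k_def of_nat_floor)
  have hk: "h m = ln (y / real m)" if "1 \<le> m" "m \<le> k" for m
    using that k by (auto simp: h_def max_def)
  have "(\<Sum>p | prime p \<and> p \<le> k. ln (y / real p)) = (\<Sum>p | prime p \<and> p \<le> k. h p)"
    by (intro sum.cong refl hk[symmetric]) (auto dest: prime_ge_1_nat)
  also have "\<dots> \<le> sqrt y * h 1 + 2 * ln 4 / ln y * (\<Sum>m=1..k. h m)"
  proof (intro sum_primes_antitone_le assms)
    fix m :: nat assume "m \<ge> 1"
    then have "ln (y / real (Suc m)) \<le> ln (y / real m)"
      using assms by (subst ln_le_cancel_iff) (auto intro!: divide_left_mono)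
    then show "h (Suc m) \<le> h m" by (auto simp: h_def)
  qed (auto simp: h_def)
  also have "(\<Sum>m=1..k. h m) \<le> y"
  proof -
    have "(\<Sum>m=1..k. h m) = (\<Sum>m=1..k. ln (y / real m))" by (intro sum.cong refl hk) auto
    also have "\<dots> = ln (\<Prod>m=1..k. y / real m)" using assms by (intro ln_prod[symmetric]) auto
    also have "(\<Prod>m=1..k. y / real m) = y ^ k / fact k"
      by (simp add: prod_dividef fact_prod)
    also have "ln (y ^ k / fact k) \<le> ln (exp y)"
      using assms power_div_fact_le_exp[of y k] by (subst ln_le_cancel_iff) auto
    finally show ?thesis by simp
  qed
  also have "sqrt y * h 1 \<le> 16 * (y / ln y)"
  proof -
    have "sqrt y * (ln y)\<^sup>2 \<le> sqrt y * (16 * sqrt y)"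
      using ln_le_sqrt(2)[of y] assms by (intro mult_left_mono) auto
    also have "\<dots> = 16 * y" using assms by simp
    finally have "sqrt y * ln y * ln y \<le> 16 * y" by (simp add: power2_eq_square mult_ac)
    then show ?thesis using assms by (simp add: h_def max_def pos_le_divide_eq)
  qed
  finally have "(\<Sum>p | prime p \<and> p \<le> k. ln (y / real p)) \<le> 16 * (y / ln y) + 2 * ln 4 / ln y * y"
    using assms by (simp add: mult_left_mono divide_right_mono)
  then show ?thesis by (simp add: k_def algebra_simps)
qed

text \<open>The admissible decrease \<open>d\<close> of the exponent must exceed a multiple of the loss, which is itself
computed at \<open>s = \<rho> - d\<close> and is of order \<open>y\<^bsup>1-\<rho>\<^esup> y\<^bsup>d\<^esup> / ln y\<close>. The circle is broken by \<open>y\<^bsup>d\<^esup> \<le> 2\<close>, which holds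
as soon as \<open>D y\<^bsup>1-\<rho>\<^esup> < ln 2\<close>.\<close>

lemma kalmar_lower:
  "\<exists>C>0. \<forall>\<^sub>F y in at_top. \<forall>n\<ge>1. ln (real n) = y powr kalmar_rho \<longrightarrow>
    (\<exists>m\<in>{1..n}. ln (real (kalmar m)) \<ge> kalmar_rho * ln (real n) - C * (y / ln y))"
proof -
  define r where "r = kalmar_rho"
  have r: "r > 1" "zeta r = 2" using kalmar_rho by (auto simp: r_def)
  define s0 where "s0 = (1 + r) / 2"
  have s0: "1 < s0" "s0 < r" using r by (auto simp: s0_def)
  define C1 where "C1 = 1 + 2 * ln 4 * 2 powr r / (s0 - 1)"
  define c where "c = 2 powr -r * ln 2"
  have C1: "C1 > 0" using s0 by (auto simp: C1_def intro!: add_pos_nonneg)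
  have c: "c > 0" by (simp add: c_def)
  have Z0: "zeta s0 > 2" using zeta_strict_antimono[of s0 r] s0 r by simp
  \<comment> \<open>Makes the loss in \<open>\<zeta>(s)\<close> at most half of the surplus \<open>c d\<close> of \<open>\<zeta>(s)\<close> over \<open>2\<close>, at \<open>s = \<rho> - d\<close>.\<close>
  define D where "D = 8 * zeta s0 * C1 / c"
  have D: "D > 0" using Z0 C1 c by (simp add: D_def)
  define C2 where "C2 = 16 + 2 * ln (4::real)"
  define C where "C = D + 2 * r * C2"
  have C2: "C2 > 0" by (simp add: C2_def add_pos_nonneg)
  have Cpos: "C > 0" using D C2 r by (simp add: C_def add_pos_nonneg)
  have lim: "((\<lambda>y. y powr (1 - r)) \<longlongrightarrow> 0) at_top"
    using r by (intro tendsto_neg_powr filterlim_ident) auto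
  have "\<forall>\<^sub>F y in at_top. y powr (1 - r) < min ((r - s0) / D) (ln 2 / D)"
    using D s0 by (intro order_tendstoD(2)[OF lim]) auto
  moreover have "\<forall>\<^sub>F y in at_top. y \<ge> exp (1::real)" by (rule eventually_ge_at_top)
  ultimately have "\<forall>\<^sub>F y in at_top. \<forall>n\<ge>1. ln (real n) = y powr r \<longrightarrow>
    (\<exists>m\<in>{1..n}. ln (real (kalmar m)) \<ge> r * ln (real n) - C * (y / ln y))"
  proof eventually_elim
    case (elim y)
    have "exp 1 > (1::real)" by simp
    with elim have y1: "y > 1" by linarith
    have lny: "ln y \<ge> 1" using elim y1 by (subst ln_ge_iff) auto
    define d where "d = D * y powr (1 - r) / ln y"
    have Dy: "D * y powr (1 - r) < r - s0" "D * y powr (1 - r) < ln 2"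
      using elim D by (auto simp: field_simps)
    have "d \<le> D * y powr (1 - r)"
      using lny D mult_left_mono[OF lny, of "D * y powr (1 - r)"] unfolding d_def by (simp add: pos_divide_le_eq)
    with Dy have d: "d > 0" "d < r - s0" using D y1 by (auto simp: d_def)
    define s where "s = r - d"
    have s: "s0 < s" "s < r" "1 < s" using d s0 by (auto simp: s_def)
    have "y powr d = exp (D * y powr (1 - r))" using y1 lny unfolding powr_def[of y d] by (simp add: d_def)
    also have "\<dots> \<le> exp (ln 2)" using Dy by (subst exp_le_cancel_iff) auto
    finally have yd: "y powr d \<le> 2" by simp
    \<comment> \<open>This is \<open>(p/y)\<^bsup>s\<^esup>\<close> up to \<open>y\<close>, and \<open>1\<close> beyond \<open>y\<close>.\<close>
    define e where "e p = (real p / max (real p) y) powr s" for p :: nat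
    have e01: "0 \<le> e p" "e p \<le> 1" for p
      using s y1 by (auto simp: e_def intro!: powr_le1)
    have epow: "e p * real p powr -s = max (real p) y powr -s" if "p > 0" for p
      using that y1 by (simp add: e_def powr_divide powr_minus_divide)
    have loss: "2 * zeta s * (\<Sum>p | prime p \<and> p \<le> X. e p * real p powr -s) \<le> c * d / 2" for X
    proof -
      have "(\<Sum>p | prime p \<and> p \<le> X. e p * real p powr -s) = (\<Sum>p | prime p \<and> p \<le> X. max (real p) y powr -s)"
        by (intro sum.cong refl epow) (auto simp: prime_gt_0_nat)
      also have "\<dots> \<le> C1 * (y powr (1 - s) / ln y)"
        unfolding C1_def using s s0 y1 by (intro sum_primes_max_powr_le) auto
      also have "y powr (1 - s) = y powr (1 - r) * y powr d"
        unfolding s_def powr_add[symmetric] by (simp add: algebra_simps)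
      also have "C1 * (y powr (1 - r) * y powr d / ln y) \<le> C1 * (y powr (1 - r) * 2 / ln y)"
        using C1 yd lny by (intro mult_left_mono divide_right_mono) auto
      finally have "2 * zeta s * (\<Sum>p | prime p \<and> p \<le> X. e p * real p powr -s)
          \<le> 2 * zeta s0 * (C1 * (y powr (1 - r) * 2 / ln y))"
        using zeta_strict_antimono[of s0 s] s s0 Z0 sum_le_zeta[of s "{}"]
        by (intro mult_mono) (auto intro!: sum_nonneg mult_nonneg_nonneg e01)
      also have "\<dots> = c * d / 2" using c D by (simp add: d_def D_def)
      finally show ?thesis .
    qed
    have "zeta s \<ge> 2 + c * d"
      using zeta_left_lower[of d] d s0 by (simp add: s_def c_def r_def)
    then have "2 + c * d / 2 < zeta s" using mult_pos_pos[OF c d(1)] by linarith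
    then have "\<forall>\<^sub>F X in sequentially. (\<Sum>x=1..X. real x powr -s) > 2 + c * d / 2"
      using s by (intro sum_ge_zeta_eventually) auto
    then have ev: "\<forall>\<^sub>F X in sequentially. (\<Sum>x=1..X. sieve_weight e x * real x powr -s) \<ge> 2"
    proof eventually_elim
      case (elim X)
      have "(\<Sum>x=1..X. sieve_weight e x * real x powr -s) \<ge> (\<Sum>x=1..X. real x powr -s)
          - 2 * zeta s * (\<Sum>p | prime p \<and> p \<le> X. e p * real p powr -s)"
        using e01 s by (intro sum_sieve_weight_powr_ge) auto
      with loss[of X] elim show ?case by linarith
    qed
    define P where "P = {p. prime p \<and> p \<le> nat \<lfloor>y\<rfloor>}"
    define N where "N = (\<Prod>p\<in>P. 1 / e p)"
    have epos: "e p > 0" if "p \<in> P" for p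
      using that y1 by (auto simp: e_def P_def prime_gt_0_nat)
    have N: "(\<Sum>x=1..X. sieve_weight e x) \<le> N" for X
      unfolding N_def
    proof (rule sum_sieve_weight_le)
      fix p :: nat assume "prime p" "p \<notin> P"
      then have "real p > y" "real p > 0"
        using y1 le_nat_floor[of p y] by (auto simp: P_def prime_gt_0_nat) linarith
      then show "e p = 1" by (simp add: e_def max_def)
    qed (use epos e01 in \<open>auto simp: P_def\<close>)
    have finP: "finite P" by (auto simp: P_def)
    have Npos: "N > 0" unfolding N_def using epos by (intro prod_pos) auto
    have "ln N = (\<Sum>p\<in>P. ln (1 / e p))"
      unfolding N_def using epos finP by (intro ln_prod) (auto simp: less_imp_neq[symmetric])
    also have "\<dots> = (\<Sum>p\<in>P. s * ln (y / real p))"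
    proof (intro sum.cong refl)
      fix p assume p: "p \<in> P"
      then have "real p \<le> real (nat \<lfloor>y\<rfloor>)" by (auto simp: P_def)
      also have "\<dots> \<le> y" using y1 by (intro of_nat_floor) auto
      finally have "real p \<le> y" .
      moreover have "p > 0" using p by (auto simp: P_def prime_gt_0_nat)
      ultimately show "ln (1 / e p) = s * ln (y / real p)"
        using y1 by (simp add: e_def max_def ln_div ln_powr powr_divide algebra_simps)
    qed
    also have "\<dots> = s * (\<Sum>p\<in>P. ln (y / real p))" by (simp add: sum_distrib_left)
    also have "\<dots> \<le> s * (C2 * (y / ln y))"
      unfolding P_def C2_def using s y1 by (intro mult_left_mono sum_primes_ln_ratio_le) auto
    also have "\<dots> \<le> r * (C2 * (y / ln y))"
      using s C2 y1 lny by (intro mult_right_mono) auto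
    finally have lnN: "ln N \<le> r * C2 * (y / ln y)" by simp
    show ?case
    proof (intro allI impI)
      fix n :: nat assume n: "1 \<le> n" "ln (real n) = y powr r"
      have "\<exists>m\<in>{1..n}. real (kalmar m) \<ge> real n powr s / N\<^sup>2"
      proof (rule kalmar_large_value[where u = "sieve_weight e"])
        show "sieve_weight e x \<ge> 0" for x by (rule sieve_weight_nonneg[OF e01])
      qed (use N ev n s in \<open>auto simp: sieve_weight_1[simplified] sieve_weight_mult\<close>)
      then obtain m where m: "m \<in> {1..n}" "real (kalmar m) \<ge> real n powr s / N\<^sup>2" by blast
      have "ln (real n powr s / N\<^sup>2) = s * ln (real n) - 2 * ln N"
        using n Npos by (simp add: ln_div ln_powr ln_realpow)
      moreover have "ln (real n powr s / N\<^sup>2) \<le> ln (real (kalmar m))"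
        using m n Npos kalmar_pos[of m] by (subst ln_le_cancel_iff) auto
      moreover have "s * ln (real n) = r * ln (real n) - D * (y / ln y)"
      proof -
        have "d * ln (real n) = D * (y powr (1 - r) * y powr r / ln y)" by (simp add: n d_def)
        also have "y powr (1 - r) * y powr r = y" using y1 by (simp add: powr_add[symmetric])
        finally show ?thesis by (simp add: s_def algebra_simps)
      qed
      ultimately have "ln (real (kalmar m)) \<ge> r * ln (real n) - D * (y / ln y) - 2 * (r * C2 * (y / ln y))"
        using lnN by linarith
      then show "\<exists>m\<in>{1..n}. ln (real (kalmar m)) \<ge> r * ln (real n) - C * (y / ln y)"
        using m(1) by (intro bexI[of _ m]) (auto simp: C_def algebra_simps)
    qed
  qed
  then show ?thesis using Cpos unfolding r_def by blast
qed

section \<open>Conclusion\<close>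

lemma ln_kalmar_le:
  assumes "n \<ge> 1"
  shows "ln (real (kalmar n)) \<le> kalmar_rho * ln (real n)"
proof -
  have "real (kalmar n) \<le> real n powr kalmar_rho"
    using assms kalmar_rho by (intro kalmar_le_of_coprime_primes[where P = "{}"]) auto
  then have "ln (real (kalmar n)) \<le> ln (real n powr kalmar_rho)"
    using assms kalmar_pos[of n] by (subst ln_le_cancel_iff) auto
  then show ?thesis using assms by (simp add: ln_powr)
qed

text \<open>The subtracted term has derivative at most \<open>C x\<^bsup>a-1\<^esup>\<close> once \<open>ln x \<ge> 1\<close>, and this tends to \<open>0\<close>.\<close>

lemma linear_minus_powr_div_ln_mono:
  fixes a r C :: real
  assumes "0 < a" "a < 1" "r > 0" "C > 0"
  shows "\<exists>T>0. (\<forall>x\<ge>T. C * (x powr a / ln x) \<le> r / 2 * x) \<and>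
    (\<forall>x1\<ge>T. \<forall>x2\<ge>x1. r * x1 - C * (x1 powr a / ln x1) \<le> r * x2 - C * (x2 powr a / ln x2))"
proof -
  have "((\<lambda>x. C * x powr (a - 1)) \<longlongrightarrow> C * 0) at_top"
    using assms by (intro tendsto_intros tendsto_neg_powr filterlim_ident) auto
  then have "\<forall>\<^sub>F x in at_top. C * x powr (a - 1) < r / 2"
    using assms by (intro order_tendstoD(2)) auto
  moreover have "\<forall>\<^sub>F x in at_top. x \<ge> exp (1::real)" by (rule eventually_ge_at_top)
  ultimately have "\<forall>\<^sub>F x in at_top. C * x powr (a - 1) < r / 2 \<and> x \<ge> exp 1"
    by eventually_elim auto
  then obtain T where T: "\<And>x. x \<ge> T \<Longrightarrow> C * x powr (a - 1) < r / 2 \<and> x \<ge> exp 1"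
    unfolding eventually_at_top_linorder by blast
  have "exp 1 > (1::real)" by simp
  with T have gt1: "x > 1" if "x \<ge> T" for x using that by (meson less_le_trans)
  have ln1: "ln x \<ge> 1" if "x \<ge> T" for x
    using T[OF that] gt1[OF that] by (subst ln_ge_iff) auto
  have small: "C * (x powr a / ln x) \<le> r / 2 * x" if x: "x \<ge> T" for x
  proof -
    have "x powr a / ln x \<le> x powr a / 1" using ln1[OF x] by (intro divide_left_mono) auto
    also have "\<dots> = x powr (a - 1) * x" using gt1[OF x] by (simp add: powr_diff)
    finally have "C * (x powr a / ln x) \<le> C * (x powr (a - 1) * x)"
      using assms by (intro mult_left_mono) auto
    also have "\<dots> \<le> r / 2 * x"
      using T[OF x] gt1[OF x] by (simp only: mult.assoc[symmetric]) (intro mult_right_mono, auto)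
    finally show ?thesis .
  qed
  have mono: "r * x1 - C * (x1 powr a / ln x1) \<le> r * x2 - C * (x2 powr a / ln x2)"
    if x12: "T \<le> x1" "x1 \<le> x2" for x1 x2
  proof (rule DERIV_nonneg_imp_nondecreasing[OF x12(2)])
    fix x assume "x1 \<le> x" "x \<le> x2"
    then have x: "x \<ge> T" using x12 by simp
    let ?D = "r - C * ((a * x powr (a - 1) * ln x - x powr a * (1 / x)) / (ln x * ln x))"
    have "((\<lambda>x. r * x - C * (x powr a / ln x)) has_real_derivative ?D) (at x)"
      using gt1[OF x] ln1[OF x] by (auto intro!: derivative_eq_intros simp: algebra_simps)
    moreover have "?D \<ge> 0"
    proof -
      have "(a * x powr (a - 1) * ln x - x powr a * (1 / x)) / (ln x * ln x)
          \<le> (x powr (a - 1) * ln x * ln x) / (ln x * ln x)"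
      proof (intro divide_right_mono)
        have "a * (x powr (a - 1) * ln x) \<le> 1 * (x powr (a - 1) * ln x)"
          using assms ln1[OF x] by (intro mult_right_mono) auto
        also have "\<dots> \<le> (x powr (a - 1) * ln x) * ln x"
          using mult_left_mono[OF ln1[OF x], of "x powr (a - 1) * ln x"] ln1[OF x] by simp
        finally show "a * x powr (a - 1) * ln x - x powr a * (1 / x) \<le> x powr (a - 1) * ln x * ln x"
          using gt1[OF x] by (smt (verit) divide_nonneg_nonneg mult.assoc mult_nonneg_nonneg powr_ge_zero)
      qed (use ln1[OF x] in auto)
      also have "\<dots> = x powr (a - 1)" using ln1[OF x] by simp
      finally have "C * ((a * x powr (a - 1) * ln x - x powr a * (1 / x)) / (ln x * ln x)) \<le> C * x powr (a - 1)"
        using assms by (intro mult_left_mono) auto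
      then show ?thesis using T[OF x] assms by linarith
    qed
    ultimately show "\<exists>D. ((\<lambda>x. r * x - C * (x powr a / ln x)) has_real_derivative D) (at x) \<and> 0 \<le> D"
      by blast
  qed
  show ?thesis
  proof (intro exI[of _ "max T 1"] conjI allI impI)
    fix x1 x2 :: real assume "max T 1 \<le> x1" "x1 \<le> x2"
    then show "r * x1 - C * (x1 powr a / ln x1) \<le> r * x2 - C * (x2 powr a / ln x2)"
      by (intro mono) auto
  qed (use small in auto)
qed

theorem mainTheorem1:
  shows "\<exists>C5 C6 :: real. C5 > 0 \<and> C6 > 0 \<and>
    (\<forall>\<^sub>F n :: nat in sequentially.
       ln (real (kalmar n)) \<le> kalmar_rho * ln (real n)
         - C5 * (ln (real n) powr (1 / kalmar_rho) / ln (ln (real n)))) \<and>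
    (\<forall>\<^sub>F n :: nat in sequentially. \<exists>m :: nat. 0 < m \<and> m \<le> n \<and>
       ln (real (kalmar m)) \<ge> kalmar_rho * ln (real n)
         - C6 * (ln (real n) powr (1 / kalmar_rho) / ln (ln (real n))) \<and>
       kalmar_rho * ln (real n)
         - C6 * (ln (real n) powr (1 / kalmar_rho) / ln (ln (real n)))
         \<ge> kalmar_rho * ln (real m)
           - C6 * (ln (real m) powr (1 / kalmar_rho) / ln (ln (real m))))"
proof -
  define r where "r = kalmar_rho"
  have r: "r > 1" using kalmar_rho by (simp add: r_def)
  define y where "y n = ln (real n) powr (1 / r)" for n :: nat
  have lim_ln: "filterlim (\<lambda>n::nat. ln (real n)) at_top sequentially"
    by (rule filterlim_compose[OF ln_at_top filterlim_real_sequentially])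
  have lim_y: "filterlim y at_top sequentially"
    unfolding y_def
    by (rule filterlim_compose[OF real_powr_at_top lim_ln]) (use r in auto)
  have y: "ln (real n) = y n powr r" "y n / ln (y n) = r * (ln (real n) powr (1 / r) / ln (ln (real n)))"
    if "n \<ge> 3" for n :: nat
  proof -
    have "ln (real n) > 0" using that by (subst ln_gt_zero_iff) auto
    then show "ln (real n) = y n powr r" "y n / ln (y n) = r * (ln (real n) powr (1 / r) / ln (ln (real n)))"
      using r by (auto simp: y_def powr_powr ln_powr)
  qed
  obtain C where C: "C > 0" and up: "\<forall>\<^sub>F y in at_top. \<forall>n\<ge>1. ln (real n) = y powr r \<longrightarrow>
      ln (real (kalmar n)) \<le> r * ln (real n) - C * (y / ln y)"
    using kalmar_upper unfolding r_def by blast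
  obtain C' where C': "C' > 0" and low: "\<forall>\<^sub>F y in at_top. \<forall>n\<ge>1. ln (real n) = y powr r \<longrightarrow>
      (\<exists>m\<in>{1..n}. ln (real (kalmar m)) \<ge> r * ln (real n) - C' * (y / ln y))"
    using kalmar_lower unfolding r_def by blast
  obtain T where T: "T > 0" "\<And>x. x \<ge> T \<Longrightarrow> C' * r * (x powr (1 / r) / ln x) \<le> r / 2 * x"
      "\<And>x1 x2. T \<le> x1 \<Longrightarrow> x1 \<le> x2 \<Longrightarrow> r * x1 - C' * r * (x1 powr (1 / r) / ln x1)
        \<le> r * x2 - C' * r * (x2 powr (1 / r) / ln x2)"
    using linear_minus_powr_div_ln_mono[of "1 / r" r "C' * r"] r C' by auto
  have "\<forall>\<^sub>F n in sequentially. ln (real (kalmar n))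
      \<le> r * ln (real n) - C * r * (ln (real n) powr (1 / r) / ln (ln (real n)))"
    using eventually_compose_filterlim[OF up lim_y] eventually_ge_at_top[of 3]
  proof eventually_elim
    case (elim n)
    then have "ln (real (kalmar n)) \<le> r * ln (real n) - C * (y n / ln (y n))"
      using y(1)[of n] by (metis le_trans one_le_numeral)
    then show ?case unfolding y(2)[OF elim(2)] by (simp only: mult.assoc)
  qed
  moreover have "\<forall>\<^sub>F n in sequentially. \<exists>m. 0 < m \<and> m \<le> n \<and>
      ln (real (kalmar m)) \<ge> r * ln (real n) - C' * r * (ln (real n) powr (1 / r) / ln (ln (real n))) \<and>
      r * ln (real n) - C' * r * (ln (real n) powr (1 / r) / ln (ln (real n)))
        \<ge> r * ln (real m) - C' * r * (ln (real m) powr (1 / r) / ln (ln (real m)))"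
    using eventually_compose_filterlim[OF low lim_y] eventually_ge_at_top[of 3]
      eventually_compose_filterlim[OF eventually_ge_at_top[of "2 * T"] lim_ln]
  proof eventually_elim
    case (elim n)
    define L where "L = ln (real n)"
    have "L \<ge> 2 * T" using elim by (simp add: L_def)
    obtain m where m: "1 \<le> m" "m \<le> n" "ln (real (kalmar m)) \<ge> r * L - C' * (y n / ln (y n))"
      using elim(1)[rule_format, of n] elim(2) y(1)[of n] unfolding L_def
      by (metis atLeastAtMost_iff le_trans one_le_numeral)
    have m': "ln (real (kalmar m)) \<ge> r * L - C' * r * (L powr (1 / r) / ln L)"
      using m(3) elim(2) y(2)[of n] by (simp add: L_def mult.assoc)
    moreover have "C' * r * (L powr (1 / r) / ln L) \<le> r / 2 * L"
      using \<open>L \<ge> 2 * T\<close> T(1) by (intro T(2)) auto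
    moreover have "ln (real (kalmar m)) \<le> r * ln (real m)"
      using ln_kalmar_le[OF m(1)] by (simp add: r_def)
    ultimately have "r * (L / 2) \<le> r * ln (real m)" by simp
    then have "L / 2 \<le> ln (real m)" using r by (subst (asm) mult_le_cancel_left_pos) auto
    then have "T \<le> ln (real m)" using \<open>L \<ge> 2 * T\<close> by simp
    moreover have "ln (real m) \<le> L" unfolding L_def using m by (subst ln_le_cancel_iff) auto
    ultimately show ?case using m m' T(3)[of "ln (real m)" L]
      by (intro exI[of _ m]) (auto simp: L_def)
  qed
  moreover have "C * r > 0" "C' * r > 0" using C C' r by auto
  ultimately show ?thesis unfolding r_def by blast
qed

end
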